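(* Let $\phi\in\mathbb{R}[x_1,\dots,x_4]$ be a unimodular Hessian potential of index $1$ with $\phi_0=\phi_1=0$ and $2\phi_2(x)=\langle Gx,x\rangle$, where $G:=\operatorname{diag}(-1,1,1,1)$. Let $\omega=(\omega_1,\dots,\omega_4)$ be a vector of positive integers, let $\lambda=(\lambda_1,\dots,\lambda_4)\in\mathbb{Q}^4$, and let $\eta\in\mathbb{C}^4$ be a generic point. If the polynomial map $G^{-1}\nabla\phi_{\geq3}\colon\mathbb{C}^4\to\mathbb{C}^4$ is weighted $\lambda$-proper at $\eta$ (with respect to the weights $\omega$) and $$\deg_\omega(\sigma_{\leq3}(L_\phi))<\sum_{i=1}^4(\lambda_i-\omega_i),$$ then $\det(L_\phi)\equiv0$.
   Context: A polynomial $\phi\in\mathbb{R}[x_1,\dots,x_n]$ is a unimodular Hessian potential of index $q$ if $\det(\operatorname{Hess}(\phi))$ is the constant polynomial $1$ or the constant polynomial $-1$, and the symmetric matrix $\operatorname{Hess}(\phi)_x$ has index $q$ (i.e. exactly $q$ negative eigenvalues, counted with multiplicity) at every $x\in\mathbb{R}^n$. Write $\phi_j$ for the homogeneous piece of $\phi$ of degree $j$, $\phi_{\geq3}:=\sum_{j\geq3}\phi_j$, and $L_\phi(x):=G^{-1}\operatorname{Hess}(\phi_{\geq3})_x$. Let $\sigma_k(L_\phi)$ be the sum of the principal $k\times k$ minors of $L_\phi$ and $\sigma_{\leq3}(L_\phi):=\sigma_1(L_\phi)+\sigma_2(L_\phi)+\sigma_3(L_\phi)$. Polynomials with real coefficients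 are also regarded as polynomials on $\mathbb{C}^4$. For a positive integral weight vector $\omega=(\omega_1,\dots,\omega_4)$, assign weight $\omega_i$ to the variable $z_i$, let $\deg_\omega$ be the weighted degree (with $\deg_\omega(0)=-\infty$), and put $\rho_\omega(z):=\max\{1,|z_1|^{1/\omega_1},\dots,|z_4|^{1/\omega_4}\}$ for $z\in\mathbb{C}^4$. For $P=(P_1,\dots,P_4)$ with $P_i\in\mathbb{C}[z_1,\dots,z_4]$ and $\lambda\in\mathbb{Q}^4$ with $\lambda_i\leq\deg_\omega(P_i)$ for all $i$, the map $P$ is weighted $\lambda$-proper at $\eta\in\mathbb{C}^4$ if there are a real constant $c>0$ and a compact set $B\subset\mathbb{C}^4$ such that $$\sum_{i=1}^4\frac{|P_i(z)-\eta_i|}{\rho_\omega(z)^{\lambda_i}}\geq c\qquad\text{for all }z\in\mathbb{C}^4\setminus B.$$ "Generic point" means a point outside a certain proper Zariski closed subset of $\mathbb{C}^4$ depending only on $\phi$; that is, the assertion is that there is a nonempty Zariski open subset $U_\phi\subseteq\mathbb{C}^4$ such that the implication holds for all $\eta\in U_\phi$. *)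

theory Defs
  imports
    "HOL-Analysis.Analysis"
    "HOL-Computational_Algebra.Polynomial"
    "HOL-Library.Poly_Mapping"
begin

section \<open>Polynomials in the variables indexed by a finite type\<close>

text \<open>A monomial is its exponent vector, and a polynomial is a finitely supported coefficient
  function on monomials; addition and (convolution) multiplication are those of
  \<^theory>\<open>HOL-Library.Poly_Mapping\<close>.\<close>

type_synonym ('a, 'n) mpoly = "('n \<Rightarrow>\<^sub>0 nat) \<Rightarrow>\<^sub>0 'a"

definition mp_const :: "'a::zero \<Rightarrow> ('a, 'n) mpoly" where
  "mp_const c = Poly_Mapping.single 0 c"

definition mp_eval :: "('a::comm_semiring_1, 'n::finite) mpoly \<Rightarrow> 'a^'n \<Rightarrow> 'a" where
  "mp_eval p x =
    (\<Sum>m\<in>Poly_Mapping.keys p. Poly_Mapping.lookup p m *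
       (\<Prod>i\<in>UNIV. (x $ i) ^ Poly_Mapping.lookup m i))"

text \<open>If the exponent of the variable i is 0, the exponent subtraction truncates, but the
  coefficient is then 0.\<close>

definition mp_partial :: "'n \<Rightarrow> ('a::comm_semiring_1, 'n) mpoly \<Rightarrow> ('a, 'n) mpoly" where
  "mp_partial i p = (\<Sum>m\<in>Poly_Mapping.keys p. Poly_Mapping.single (m - Poly_Mapping.single i 1)
                                     (of_nat (Poly_Mapping.lookup m i) * Poly_Mapping.lookup p m))"

definition mp_grad :: "('a::comm_semiring_1, 'n::finite) mpoly \<Rightarrow> ('a, 'n) mpoly ^ 'n" where
  "mp_grad p = (\<chi> i. mp_partial i p)"

definition mp_hess :: "('a::comm_semiring_1, 'n::finite) mpoly \<Rightarrow> ('a, 'n) mpoly ^ 'n ^ 'n" where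
  "mp_hess p = (\<chi> i j. mp_partial i (mp_partial j p))"

definition mp_complex :: "(real, 'n) mpoly \<Rightarrow> (complex, 'n) mpoly" where
  "mp_complex = Poly_Mapping.map complex_of_real"

definition mon_degree :: "('n::finite \<Rightarrow>\<^sub>0 nat) \<Rightarrow> nat" where
  "mon_degree m = (\<Sum>i\<in>UNIV. Poly_Mapping.lookup m i)"

definition hom_part :: "nat \<Rightarrow> ('a::comm_semiring_1, 'n::finite) mpoly \<Rightarrow> ('a, 'n) mpoly" where
  "hom_part j p = (\<Sum>m\<in>{m \<in> Poly_Mapping.keys p. mon_degree m = j}.
                     Poly_Mapping.single m (Poly_Mapping.lookup p m))"

text \<open>The sum of all homogeneous pieces of degree at least d; only the finitely many degrees
  that occur in p contribute.\<close>

definition hom_part_ge :: "nat \<Rightarrow> ('a::comm_semiring_1, 'n::finite) mpoly \<Rightarrow> ('a, 'n) mpoly" where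
  "hom_part_ge d p = (\<Sum>j\<in>{j \<in> mon_degree ` Poly_Mapping.keys p. d \<le> j}. hom_part j p)"

text \<open>The supremum of the empty set of extended reals is \<^term>\<open>-\<infinity> :: ereal\<close>, which is thus the
  weighted degree of 0.\<close>

definition wdeg :: "nat^'n::finite \<Rightarrow> ('a::zero, 'n) mpoly \<Rightarrow> ereal" where
  "wdeg \<omega> p =
     (SUP m\<in>Poly_Mapping.keys p. ereal (real (\<Sum>i\<in>UNIV. \<omega> $ i * Poly_Mapping.lookup m i)))"

definition zariski_open :: "(complex^'n::finite) set \<Rightarrow> bool" where
  "zariski_open U \<longleftrightarrow> (\<exists>F :: (complex, 'n) mpoly set. - U = {z. \<forall>p\<in>F. mp_eval p z = 0})"


section \<open>Matrices\<close>

text \<open>The Leibniz expansion of the determinant of the submatrix of A with rows and columns in S.\<close>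

definition principal_minor :: "'a::comm_ring_1 ^'n^'n \<Rightarrow> 'n::finite set \<Rightarrow> 'a" where
  "principal_minor A S = (\<Sum>\<pi> | \<pi> permutes S. of_int (sign \<pi>) * (\<Prod>i\<in>S. A $ i $ \<pi> i))"

definition minor_sum :: "nat \<Rightarrow> 'a::comm_ring_1 ^'n^'n \<Rightarrow> 'a" where
  "minor_sum k A = (\<Sum>S | card S = k. principal_minor A S)"

definition charac_poly :: "'a::comm_ring_1 ^'n^'n \<Rightarrow> 'a poly" where
  "charac_poly A = det (mat [:0, 1:] - map_matrix (\<lambda>a. [:a:]) A)"

text \<open>The number of negative eigenvalues; they are counted with algebraic multiplicity, which for
  the symmetric matrices considered here is also the geometric one.\<close>

definition matrix_index :: "real^'n^'n \<Rightarrow> nat" where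
  "matrix_index A = (\<Sum>c | c < 0 \<and> poly (charac_poly A) c = 0. order c (charac_poly A))"


section \<open>Unimodular Hessian potentials and weighted properness\<close>

definition unimodular_hessian_potential :: "nat \<Rightarrow> (real, 'n::finite) mpoly \<Rightarrow> bool" where
  "unimodular_hessian_potential q \<phi> \<longleftrightarrow>
     (det (mp_hess \<phi>) = 1 \<or> det (mp_hess \<phi>) = -1) \<and>
     (\<forall>x. matrix_index (map_matrix (\<lambda>p. mp_eval p x) (mp_hess \<phi>)) = q)"

definition wrho :: "nat^'n::finite \<Rightarrow> complex^'n \<Rightarrow> real" where
  "wrho \<omega> z = Max (insert 1 (range (\<lambda>i. cmod (z $ i) powr (1 / real (\<omega> $ i)))))"

definition weighted_proper_at ::
  "nat^'n::finite \<Rightarrow> rat^'n \<Rightarrow> (complex, 'n) mpoly ^ 'n \<Rightarrow> complex^'n \<Rightarrow> bool" where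
  "weighted_proper_at \<omega> lam P \<eta> \<longleftrightarrow>
     (\<forall>i. ereal (of_rat (lam $ i)) \<le> wdeg \<omega> (P $ i)) \<and>
     (\<exists>c>0. \<exists>B. compact B \<and>
        (\<forall>z. z \<notin> B \<longrightarrow>
           c \<le> (\<Sum>i\<in>UNIV. cmod (mp_eval (P $ i) z - \<eta> $ i) / wrho \<omega> z powr of_rat (lam $ i))))"


section \<open>The Lorentzian case in dimension 4\<close>

text \<open>The elements of the index type are 1, 2, 3 and 4 = 0.\<close>

definition Gmat :: "real^4^4" where
  "Gmat = (\<chi> i j. if i = j then (if i = 1 then -1 else 1) else 0)"

definition L_mat :: "(real, 4) mpoly \<Rightarrow> (real, 4) mpoly ^4^4" where
  "L_mat \<phi> = map_matrix mp_const (matrix_inv Gmat) ** mp_hess (hom_part_ge 3 \<phi>)"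

definition gradient_map :: "(real, 4) mpoly \<Rightarrow> (complex, 4) mpoly ^4" where
  "gradient_map \<phi> =
     (\<chi> i. mp_complex ((map_matrix mp_const (matrix_inv Gmat) *v mp_grad (hom_part_ge 3 \<phi>)) $ i))"

definition sigma_le3 :: "(real, 4) mpoly \<Rightarrow> (real, 4) mpoly" where
  "sigma_le3 \<phi> = minor_sum 1 (L_mat \<phi>) + minor_sum 2 (L_mat \<phi>) + minor_sum 3 (L_mat \<phi>)"

end

theory Submission
  imports Defs
begin

text \<open>Write F for the gradient map and J for its Jacobian determinant, which is det L. The Hessian
  factors as G (1 + L), and comparison of determinants at the origin shows det (1 + L) = 1. The
  expansion of det (1 + L) in principal minors then says that the sum of the first three minor sums
  is - J (\<^emph>\<open>sigma_le3_eq_minus_det\<close>). So the statement becomes one about an arbitrary polynomial map F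
  of complex affine n-space: if F is weighted lam-proper at a generic value and J is not zero, then
  the weighted degree of J is at least the sum of the lam $ i - \<omega> $ i.

  This is a comparison of volumes (\<^emph>\<open>weighted_proper_wdeg_jacobian\<close>). For large R let K be the
  polydisc of weighted radius R and let W be the box around \<eta> with sides of order R powr lam $ i.
  Properness keeps F (z) outside W for z on the boundary of K. If \<eta> is a regular value
  that is attained, then F (K) covers W: its trace on W is closed, it is open off a complex hypersurface that contains
  the critical values, and the complement of that hypersurface in W is connected
  (\<^emph>\<open>weighted_proper_image_covers_box\<close>). The volume of W is therefore at most the supremum of
  the squared absolute value of J on K times the volume of K (\<^emph>\<open>poly_map_volume_bound\<close>), and
  letting R tend to infinity compares the exponents of R.

  Genericity comes from algebraic dependence (\<^emph>\<open>algebraic_dependence\<close>): n + 1 polynomials in n variables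
  satisfy a polynomial relation, by a dimension count. The relation between F and J yields a
  hypersurface through all critical values, and the relations between F and each coordinate bound
  the fibres of F away from a hypersurface. Off both hypersurfaces F is proper and open, so all values
  there are attained (\<^emph>\<open>poly_map_generic_values\<close>).\<close>

section \<open>Polynomials and their evaluation\<close>

lemma poly_mapping_add_induct [case_names zero single add]:
  fixes p :: "'a \<Rightarrow>\<^sub>0 'b::comm_monoid_add"
  assumes "P 0" "\<And>m c. P (Poly_Mapping.single m c)" "\<And>p q. P p \<Longrightarrow> P q \<Longrightarrow> P (p + q)"
  shows "P p"
proof (induction p rule: Poly_Mapping.update_induct)
  case (update f a b)
  have "Poly_Mapping.update a b f = Poly_Mapping.single a b + f"
    using update(1)
    by (intro poly_mapping_eqI)
       (auto simp: lookup_update lookup_add lookup_single when_def in_keys_iff)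
  then show ?case using assms update by simp
qed (rule assms)

definition mon_eval :: "('n::finite \<Rightarrow>\<^sub>0 nat) \<Rightarrow> 'a::comm_semiring_1 ^ 'n \<Rightarrow> 'a" where
  "mon_eval m x = (\<Prod>i\<in>UNIV. (x $ i) ^ Poly_Mapping.lookup m i)"

lemma mon_eval_add: "mon_eval (m + m') x = mon_eval m x * mon_eval m' x"
  by (simp add: mon_eval_def lookup_add power_add prod.distrib)

lemma mon_eval_0 [simp]: "mon_eval 0 x = 1"
  by (simp add: mon_eval_def)

lemma mp_eval_superset:
  assumes "finite A" "Poly_Mapping.keys p \<subseteq> A"
  shows "mp_eval p x = (\<Sum>m\<in>A. Poly_Mapping.lookup p m * mon_eval m x)"
  unfolding mp_eval_def mon_eval_def
  by (rule sum.mono_neutral_left) (use assms in \<open>auto simp: in_keys_iff\<close>)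

lemma mp_eval_0 [simp]: "mp_eval 0 x = 0"
  by (simp add: mp_eval_def)

lemma mp_eval_single: "mp_eval (Poly_Mapping.single m c) x = c * mon_eval m x"
  by (subst mp_eval_superset[of "{m}"]) (auto split: if_splits)

lemma mp_eval_add [simp]: "mp_eval (p + q) x = mp_eval p x + mp_eval q x"
proof -
  let ?A = "Poly_Mapping.keys p \<union> Poly_Mapping.keys q"
  show ?thesis
    using keys_add[of p q]
    by (subst (1 2 3) mp_eval_superset[of ?A])
       (auto simp: lookup_add algebra_simps sum.distrib)
qed

lemma mp_eval_mult [simp]: "mp_eval (p * q) x = mp_eval p x * mp_eval q x"
proof (induction p rule: poly_mapping_add_induct)
  case (single m c)
  show ?case
  proof (induction q rule: poly_mapping_add_induct)
    case (single m' c')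
    then show ?case
      by (simp add: mult_single mp_eval_single mon_eval_add algebra_simps)
  qed (simp_all add: algebra_simps)
qed (simp_all add: algebra_simps)

lemma mp_eval_1 [simp]: "mp_eval 1 x = 1"
  using mp_eval_single[of 0 1 x] by simp

lemma mp_eval_const [simp]: "mp_eval (mp_const c) x = c"
  by (simp add: mp_const_def mp_eval_single)

lemma mp_eval_uminus [simp]: "mp_eval (- p) x = - mp_eval (p :: ('a::comm_ring_1, 'n::finite) mpoly) x"
  using mp_eval_add[of p "-p" x] by (simp add: add_eq_0_iff)

lemma mp_eval_diff [simp]:
  "mp_eval (p - q) x = mp_eval p x - mp_eval (q :: ('a::comm_ring_1, 'n::finite) mpoly) x"
  using mp_eval_add[of p "-q" x] by simp

lemma mp_eval_sum [simp]: "mp_eval (sum f A) x = (\<Sum>a\<in>A. mp_eval (f a) x)"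
  by (induction A rule: infinite_finite_induct) auto

lemma mp_eval_prod [simp]: "mp_eval (prod f A) x = (\<Prod>a\<in>A. mp_eval (f a) x)"
  by (induction A rule: infinite_finite_induct) auto

lemma mp_eval_power [simp]: "mp_eval (p ^ k) x = mp_eval p x ^ k"
  by (induction k) auto

lemma mp_eval_of_int [simp]: "mp_eval (of_int k :: ('a::comm_ring_1, 'n::finite) mpoly) x = of_int k"
  using mp_eval_single[of 0 "of_int k" x] by simp

lemma mp_eval_det:
  "mp_eval (det A) x = det (map_matrix (\<lambda>p. mp_eval p x) (A :: ('a::comm_ring_1, 'n::finite) mpoly ^ 'm ^ 'm))"
  by (simp add: det_def map_matrix_def)

subsection \<open>Complexification of real polynomials\<close>

lemma lookup_mp_complex [simp]:
  "Poly_Mapping.lookup (mp_complex p) m = complex_of_real (Poly_Mapping.lookup p m)"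
  by (simp add: mp_complex_def map.rep_eq when_def)

lemma keys_mp_complex [simp]: "Poly_Mapping.keys (mp_complex p) = Poly_Mapping.keys p"
  by (auto simp: in_keys_iff)

lemma mp_complex_single: "mp_complex (Poly_Mapping.single m c) = Poly_Mapping.single m (of_real c)"
  by (intro poly_mapping_eqI) (auto simp: lookup_single when_def)

lemma mp_complex_add [simp]: "mp_complex (p + q) = mp_complex p + mp_complex q"
  by (intro poly_mapping_eqI) (auto simp: lookup_add)

lemma mp_complex_0 [simp]: "mp_complex 0 = 0"
  by (intro poly_mapping_eqI) auto

lemma mp_complex_eq_0_iff [simp]: "mp_complex p = 0 \<longleftrightarrow> p = 0"
  using keys_mp_complex[of p] by (metis keys_eq_empty)

lemma mp_complex_mult [simp]:
  "mp_complex (p * q) = mp_complex p * mp_complex (q :: (real, 'n::finite) mpoly)"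
proof (induction p rule: poly_mapping_add_induct)
  case (single m c)
  show ?case
  proof (induction q rule: poly_mapping_add_induct)
    case (single m' c')
    then show ?case
      by (simp add: mult_single mp_complex_single)
  qed (simp_all add: algebra_simps)
qed (simp_all add: algebra_simps)

lemma mp_complex_sum [simp]: "mp_complex (sum f A) = (\<Sum>a\<in>A. mp_complex (f a))"
  by (induction A rule: infinite_finite_induct) auto

lemma mp_complex_of_int [simp]: "mp_complex (of_int k) = (of_int k :: (complex, 'n::finite) mpoly)"
  using mp_complex_single[of 0 "of_int k"] by simp

lemma mp_complex_prod [simp]:
  "mp_complex (prod f A) = (\<Prod>a\<in>A. mp_complex (f a :: (real, 'n::finite) mpoly))"
  by (induction A rule: infinite_finite_induct)
     (auto simp: mp_complex_of_int[of 1, simplified])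

lemma mp_complex_det:
  "mp_complex (det A) = det (map_matrix mp_complex (A :: (real, 'n::finite) mpoly ^ 'm ^ 'm))"
  by (simp add: det_def map_matrix_def)

subsection \<open>Partial derivatives\<close>

text \<open>In terms of coefficients the truncated subtraction of exponents disappears, because the monomials
  on which it truncates contribute 0.\<close>

lemma lookup_mp_partial:
  fixes p :: "('a::comm_semiring_1, 'n) mpoly"
  shows "Poly_Mapping.lookup (mp_partial i p) m =
    of_nat (Suc (Poly_Mapping.lookup m i)) * Poly_Mapping.lookup p (m + Poly_Mapping.single i 1)"
proof -
  let ?e = "Poly_Mapping.single i 1 :: 'n \<Rightarrow>\<^sub>0 nat"
  let ?K = "Poly_Mapping.keys p" and ?l = Poly_Mapping.lookup
  have eq: "(of_nat (?l m' i) * ?l p m' when m' - ?e = m) =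
    (if m' = m + ?e then of_nat (Suc (?l m i)) * ?l p (m + ?e) else 0)" for m'
  proof (cases "m' = m + ?e")
    case True
    then show ?thesis by (simp add: lookup_add)
  next
    case False
    have "?l m' i = 0" if "m' - ?e = m"
    proof (rule ccontr)
      assume "?l m' i \<noteq> 0"
      then have "m' = m' - ?e + ?e"
        by (intro poly_mapping_eqI) (auto simp: lookup_add lookup_minus lookup_single when_def)
      with that False show False by simp
    qed
    then show ?thesis using False by (auto simp: when_def)
  qed
  have "?l (mp_partial i p) m = (\<Sum>m'\<in>?K. of_nat (?l m' i) * ?l p m' when m' - ?e = m)"
    by (simp add: mp_partial_def lookup_sum lookup_single)
  also have "\<dots> = (if m + ?e \<in> ?K then of_nat (Suc (?l m i)) * ?l p (m + ?e) else 0)"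
    unfolding eq by (simp add: sum.delta)
  also have "\<dots> = of_nat (Suc (?l m i)) * ?l p (m + ?e)"
    by (auto simp: in_keys_iff)
  finally show ?thesis .
qed

lemma mp_partial_add [simp]: "mp_partial i (p + q) = mp_partial i p + mp_partial i q"
  by (intro poly_mapping_eqI) (simp add: lookup_mp_partial lookup_add algebra_simps)

lemma mp_partial_0 [simp]: "mp_partial i 0 = 0"
  by (intro poly_mapping_eqI) (simp add: lookup_mp_partial)

lemma mp_partial_commute: "mp_partial i (mp_partial j p) = mp_partial j (mp_partial i p)"
  by (intro poly_mapping_eqI)
     (auto simp: lookup_mp_partial lookup_add lookup_single when_def add_ac mult_ac)

lemma mp_partial_mp_complex: "mp_partial i (mp_complex p) = mp_complex (mp_partial i p)"
  by (intro poly_mapping_eqI) (simp add: lookup_mp_partial)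

lemma mp_partial_single:
  "mp_partial i (Poly_Mapping.single m c) =
     Poly_Mapping.single (m - Poly_Mapping.single i 1) (of_nat (Poly_Mapping.lookup m i) * c)"
  by (cases "c = 0") (auto simp: mp_partial_def)

lemma has_derivative_mp_eval:
  fixes p :: "('a::real_normed_field, 'n::finite) mpoly"
  shows "(mp_eval p has_derivative (\<lambda>v. \<Sum>i\<in>UNIV. mp_eval (mp_partial i p) x * v $ i)) (at x within S)"
proof (induction p rule: poly_mapping_add_induct)
  case zero
  then show ?case by (simp add: mp_eval_def[abs_def])
next
  case (single m c)
  have 1: "mon_eval (m - Poly_Mapping.single i 1) x * of_nat (Poly_Mapping.lookup m i) =
        of_nat (Poly_Mapping.lookup m i) * x $ i ^ (Poly_Mapping.lookup m i - 1) *
        (\<Prod>j\<in>UNIV - {i}. x $ j ^ Poly_Mapping.lookup m j)" for i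
    unfolding mon_eval_def
    by (subst prod.remove[of _ i]) (auto simp: lookup_minus lookup_single when_def)
  have 2: "mp_eval (mp_partial i (Poly_Mapping.single m c)) x * v $ i =
      c * ((of_nat (Poly_Mapping.lookup m i) * v $ i * x $ i ^ (Poly_Mapping.lookup m i - 1)) *
        (\<Prod>j\<in>UNIV - {i}. x $ j ^ Poly_Mapping.lookup m j))" for i v
  proof -
    have "mp_eval (mp_partial i (Poly_Mapping.single m c)) x * v $ i =
        c * v $ i * (mon_eval (m - Poly_Mapping.single i 1) x * of_nat (Poly_Mapping.lookup m i))"
      by (simp add: mp_partial_single mp_eval_single mult_ac)
    then show ?thesis
      unfolding 1 by (simp add: mult_ac)
  qed
  have "((\<lambda>x. c * mon_eval m x) has_derivative
      (\<lambda>v. c * (\<Sum>i\<in>UNIV. (of_nat (Poly_Mapping.lookup m i) * v $ i * x $ i ^ (Poly_Mapping.lookup m i - 1)) *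
        (\<Prod>j\<in>UNIV - {i}. x $ j ^ Poly_Mapping.lookup m j)))) (at x within S)"
    unfolding mon_eval_def
    by (intro has_derivative_mult_right has_derivative_prod has_derivative_power
          bounded_linear_imp_has_derivative bounded_linear_vec_nth)
  also have "(\<lambda>x. c * mon_eval m x) = mp_eval (Poly_Mapping.single m c)"
    by (simp add: mp_eval_single fun_eq_iff)
  also have "(\<lambda>v. c * (\<Sum>i\<in>UNIV. (of_nat (Poly_Mapping.lookup m i) * v $ i * x $ i ^ (Poly_Mapping.lookup m i - 1)) *
        (\<Prod>j\<in>UNIV - {i}. x $ j ^ Poly_Mapping.lookup m j))) =
     (\<lambda>v. \<Sum>i\<in>UNIV. mp_eval (mp_partial i (Poly_Mapping.single m c)) x * v $ i)"
    by (simp only: 2 sum_distrib_left)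
  finally show ?case .
next
  case (add p q)
  have "((\<lambda>x. mp_eval p x + mp_eval q x) has_derivative
     (\<lambda>v. (\<Sum>i\<in>UNIV. mp_eval (mp_partial i p) x * v $ i) +
          (\<Sum>i\<in>UNIV. mp_eval (mp_partial i q) x * v $ i))) (at x within S)"
    by (rule has_derivative_add[OF add])
  moreover have "mp_eval (p + q) = (\<lambda>x. mp_eval p x + mp_eval q x)"
    by (simp add: fun_eq_iff)
  ultimately show ?case
    by (simp add: algebra_simps sum.distrib)
qed

lemma continuous_on_mp_eval [continuous_intros]:
  fixes p :: "('a::real_normed_field, 'n::finite) mpoly"
  assumes "continuous_on S f"
  shows "continuous_on S (\<lambda>x. mp_eval p (f x))"
proof -
  have "continuous_on UNIV (mp_eval p)"
    by (meson has_derivative_continuous_on has_derivative_mp_eval)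
  then show ?thesis
    using assms continuous_on_compose2 by blast
qed

lemma mp_eval_partial_eqI:
  fixes p :: "('a::real_normed_field, 'n::finite) mpoly"
  assumes "(mp_eval p has_derivative D) (at x)"
  shows "mp_eval (mp_partial i p) x = D (axis i 1)"
proof -
  have "D = (\<lambda>v. \<Sum>i\<in>UNIV. mp_eval (mp_partial i p) x * v $ i)"
    by (rule has_derivative_unique[OF assms has_derivative_mp_eval])
  moreover have "(\<Sum>j\<in>UNIV. mp_eval (mp_partial j p) x * axis i 1 $ j) = mp_eval (mp_partial i p) x"
    by (simp add: axis_def if_distrib cong: if_cong)
  ultimately show ?thesis by simp
qed

lemma mp_partial_eval_eq_0:
  fixes p :: "('a::real_normed_field, 'n::finite) mpoly"
  assumes "open S" "x \<in> S" "\<And>y. y \<in> S \<Longrightarrow> mp_eval p y = 0"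
  shows "mp_eval (mp_partial i p) x = 0"
proof -
  have "((\<lambda>_. 0 :: 'a) has_derivative (\<lambda>_. 0)) (at x)" by simp
  then have "(mp_eval p has_derivative (\<lambda>_. 0)) (at x)"
    using has_derivative_transform_within_open[of "\<lambda>_. 0" _ x UNIV S "mp_eval p"] assms by simp
  from mp_eval_partial_eqI[OF this] show ?thesis by simp
qed

text \<open>Identity theorem: the first-order partial derivatives also vanish on the open set, so by
  induction on the degree they are zero polynomials; hence the polynomial is constant.\<close>

lemma mp_eval_open_eq_0:
  fixes p :: "('a::real_normed_field, 'n::finite) mpoly"
  assumes "open S" "S \<noteq> {}" "\<And>x. x \<in> S \<Longrightarrow> mp_eval p x = 0"
  shows "p = 0"
proof -
  let ?l = Poly_Mapping.lookup
  have "\<forall>m\<in>Poly_Mapping.keys p. mon_degree m \<le> d \<Longrightarrow> (\<And>x. x \<in> S \<Longrightarrow> mp_eval p x = 0) \<Longrightarrow> p = 0"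
    for d and p :: "('a, 'n) mpoly"
  proof (induction d arbitrary: p)
    case 0
    have sub: "Poly_Mapping.keys p \<subseteq> {0}"
    proof
      fix m assume "m \<in> Poly_Mapping.keys p"
      with 0 have "mon_degree m = 0" by auto
      then have "m = 0" by (intro poly_mapping_eqI) (auto simp: mon_degree_def)
      then show "m \<in> {0}" by simp
    qed
    obtain x where "x \<in> S" using assms by blast
    then have "?l p 0 = 0"
      using 0(2)[of x] mp_eval_superset[OF _ sub, of x] by simp
    with sub show ?case
      by (metis in_keys_iff keys_eq_empty singletonD subset_singleton_iff insertI1)
  next
    case (Suc d)
    have part: "mp_partial i p = 0" for i
    proof (rule Suc.IH)
      show "\<forall>m\<in>Poly_Mapping.keys (mp_partial i p). mon_degree m \<le> d"
      proof
        fix m assume "m \<in> Poly_Mapping.keys (mp_partial i p)"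
        then have "?l p (m + Poly_Mapping.single i 1) \<noteq> 0"
          by (auto simp: in_keys_iff lookup_mp_partial)
        then have "mon_degree (m + Poly_Mapping.single i 1) \<le> Suc d"
          using Suc.prems by (auto simp: in_keys_iff)
        then show "mon_degree m \<le> d"
          by (simp add: mon_degree_def lookup_add sum.distrib lookup_single when_def)
      qed
    qed (use mp_partial_eval_eq_0[OF assms(1)] Suc.prems in blast)
    have "mon_degree m \<le> d" if "m \<in> Poly_Mapping.keys p" for m
    proof (cases "m = 0")
      case True
      then show ?thesis by (simp add: mon_degree_def)
    next
      case False
      then obtain i where i: "?l m i \<noteq> 0"
        by (metis poly_mapping_eqI lookup_zero)
      then have m: "m = (m - Poly_Mapping.single i 1) + Poly_Mapping.single i 1"
        by (intro poly_mapping_eqI) (auto simp: lookup_add lookup_minus lookup_single when_def)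
      have "?l (mp_partial i p) (m - Poly_Mapping.single i 1) = 0"
        by (simp add: part)
      then have "?l p m = 0"
        unfolding lookup_mp_partial m[symmetric] by (simp del: of_nat_Suc)
      with that show ?thesis by (simp add: in_keys_iff)
    qed
    then show ?case using Suc by blast
  qed
  moreover have "\<forall>m\<in>Poly_Mapping.keys p. mon_degree m \<le> Max (insert 0 (mon_degree ` Poly_Mapping.keys p))"
    by (auto intro!: Max_ge)
  ultimately show ?thesis using assms(3) by blast
qed

lemma mp_eqI:
  fixes p q :: "('a::real_normed_field, 'n::finite) mpoly"
  assumes "\<And>x. mp_eval p x = mp_eval q x"
  shows "p = q"
  using mp_eval_open_eq_0[of UNIV "p - q"] assms by simp

lemma mp_mult_eq_0:
  fixes p q :: "('a::real_normed_field, 'n::finite) mpoly"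
  assumes "p * q = 0" shows "p = 0 \<or> q = 0"
proof (rule ccontr)
  assume *: "\<not> (p = 0 \<or> q = 0)"
  have "open {x. mp_eval p x \<noteq> 0}"
    by (intro open_Collect_neq continuous_intros)
  moreover have "{x. mp_eval p x \<noteq> 0} \<noteq> {}"
    using mp_eqI[of p 0] * by auto
  moreover have "mp_eval q x = 0" if "x \<in> {x. mp_eval p x \<noteq> 0}" for x
    using that mp_eval_mult[of p q x] assms by simp
  ultimately have "q = 0" by (rule mp_eval_open_eq_0)
  with * show False by simp
qed

lemma mp_prod_nonzero:
  fixes f :: "'i \<Rightarrow> ('a::real_normed_field, 'n::finite) mpoly"
  assumes "\<And>i. i \<in> A \<Longrightarrow> f i \<noteq> 0" shows "prod f A \<noteq> 0"
  using assms
proof (induction A rule: infinite_finite_induct)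
  case (insert i A)
  then show ?case using mp_mult_eq_0[of "f i" "prod f A"] by auto
qed (auto simp: one_neq_zero)

section \<open>Polynomial maps\<close>

definition poly_map :: "('a::comm_semiring_1, 'n::finite) mpoly ^ 'm \<Rightarrow> 'a ^ 'n \<Rightarrow> 'a ^ 'm" where
  "poly_map F z = (\<chi> i. mp_eval (F $ i) z)"

definition mp_jacobian :: "('a::comm_semiring_1, 'n) mpoly ^ 'm \<Rightarrow> ('a, 'n) mpoly ^ 'n ^ 'm" where
  "mp_jacobian F = (\<chi> i k. mp_partial k (F $ i))"

abbreviation jacobian_at :: "('a::comm_semiring_1, 'n::finite) mpoly ^ 'm \<Rightarrow> 'a ^ 'n \<Rightarrow> 'a ^ 'n ^ 'm" where
  "jacobian_at F z \<equiv> map_matrix (\<lambda>p. mp_eval p z) (mp_jacobian F)"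

lemma poly_map_nth [simp]: "poly_map F z $ i = mp_eval (F $ i) z"
  by (simp add: poly_map_def)

lemma continuous_on_poly_map [continuous_intros]:
  fixes F :: "(complex, 'n::finite) mpoly ^ 'm"
  assumes "continuous_on S f"
  shows "continuous_on S (\<lambda>x. poly_map F (f x))"
  unfolding poly_map_def by (intro continuous_intros assms)

lemma has_derivative_poly_map:
  fixes F :: "(complex, 'n::finite) mpoly ^ 'm"
  shows "(poly_map F has_derivative (*v) (jacobian_at F z)) (at z within S)"
proof (subst has_derivative_componentwise_within, intro ballI)
  fix b :: "complex ^ 'm" assume "b \<in> Basis"
  then obtain i u where b: "b = axis i u" by (auto simp: Basis_vec_def)
  have "(\<lambda>v. (jacobian_at F z *v v) \<bullet> b) =
      (\<lambda>v. (\<Sum>k\<in>UNIV. mp_eval (mp_partial k (F $ i)) z * v $ k) \<bullet> u)"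
    by (simp add: b inner_axis matrix_vector_mult_def mp_jacobian_def map_matrix_def)
  then show "((\<lambda>x. poly_map F x \<bullet> b) has_derivative (\<lambda>v. (jacobian_at F z *v v) \<bullet> b)) (at z within S)"
    by (simp add: b inner_axis has_derivative_mp_eval has_derivative_inner_left)
qed

lemma poly_map_interior_image:
  fixes F :: "(complex, 'n::finite) mpoly ^ 'n"
  assumes "mp_eval (det (mp_jacobian F)) z \<noteq> 0" "open S" "z \<in> S"
  shows "poly_map F z \<in> interior (poly_map F ` S)"
proof -
  have "invertible (jacobian_at F z)"
    using assms(1) by (simp add: mp_eval_det invertible_det_nz)
  then obtain B where B: "jacobian_at F z ** B = mat 1"
    using invertible_right_inverse by blast
  show ?thesis
  proof (rule sussmann_open_mapping)
    show "((*v) (jacobian_at F z)) \<circ> ((*v) B) = id"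
      using B by (simp add: fun_eq_iff matrix_vector_mul_assoc)
    show "continuous_on S (poly_map F)"
      using continuous_on_poly_map[OF continuous_on_id] by simp
    show "z \<in> interior S"
      using assms by (simp add: interior_open)
  qed (use assms has_derivative_poly_map in auto)
qed

text \<open>A polynomial map with nonzero Jacobian determinant is dominant, since its image has
  interior points.\<close>

lemma poly_map_dominant:
  fixes F :: "(complex, 'n::finite) mpoly ^ 'n"
  assumes J: "det (mp_jacobian F) \<noteq> 0" and D: "D \<noteq> 0"
  obtains z where "mp_eval D (poly_map F z) \<noteq> 0"
proof -
  obtain z where "mp_eval (det (mp_jacobian F)) z \<noteq> 0"
    using mp_eqI[of "det (mp_jacobian F)" 0] J by auto
  from poly_map_interior_image[OF this, of UNIV]
  have "interior (range (poly_map F)) \<noteq> {}" by auto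
  with D mp_eval_open_eq_0[of "interior (range (poly_map F))" D]
  obtain w where "w \<in> interior (range (poly_map F))" "mp_eval D w \<noteq> 0" by auto
  then show thesis using that interior_subset by blast
qed

section \<open>Algebraic dependence by counting dimensions\<close>

text \<open>Stated for a family rather than a set: products of powers of given polynomials may
  coincide, and a coincidence is already a linear relation.\<close>

lemma (in vector_space) family_dependent:
  assumes "finite I" "finite T" "card T < card I" "v ` I \<subseteq> span T"
  obtains c where "\<exists>x\<in>I. c x \<noteq> 0" "(\<Sum>x\<in>I. scale (c x) (v x)) = 0"
proof (cases "inj_on v I")
  case True
  then have "dependent (v ` I)"
    using independent_span_bound[OF assms(2) _ assms(4)] assms(3)
    by (auto simp: card_image)
  then obtain u where u: "\<exists>w\<in>v ` I. u w \<noteq> 0" "(\<Sum>w\<in>v ` I. scale (u w) w) = 0"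
    using dependent_finite[of "v ` I"] assms(1) by auto
  then have "(\<Sum>x\<in>I. scale (u (v x)) (v x)) = 0"
    by (simp add: sum.reindex[OF True])
  with u(1) show thesis using that[of "u \<circ> v"] by auto
next
  case False
  then obtain x y where xy: "x \<in> I" "y \<in> I" "x \<noteq> y" "v x = v y"
    by (auto simp: inj_on_def)
  define c where "c = (\<lambda>z. if z = x then 1 else if z = y then -1 else 0 :: 'a)"
  have "(\<Sum>z\<in>I. scale (c z) (v z)) = (\<Sum>z\<in>{x, y}. scale (c z) (v z))"
    by (rule sum.mono_neutral_right) (use assms xy in \<open>auto simp: c_def\<close>)
  also have "\<dots> = 0" using xy by (simp add: c_def)
  finally have "(\<Sum>z\<in>I. scale (c z) (v z)) = 0" .
  moreover have "\<exists>z\<in>I. c z \<noteq> 0" using xy(1) by (auto simp: c_def)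
  ultimately show thesis by (rule that[rotated])
qed

definition exponent_box :: "nat \<Rightarrow> ('n \<Rightarrow>\<^sub>0 nat) set" where
  "exponent_box N = {m. \<forall>i. Poly_Mapping.lookup m i \<le> N}"

lemma exponent_box_bij:
  "bij_betw Poly_Mapping.lookup (exponent_box N :: ('n::finite \<Rightarrow>\<^sub>0 nat) set) (PiE UNIV (\<lambda>_. {..N}))"
proof (rule bij_betwI')
  fix f :: "'n \<Rightarrow> nat" assume f: "f \<in> PiE UNIV (\<lambda>_. {..N})"
  have "Poly_Mapping.lookup (Abs_poly_mapping f) = f"
    by (rule Abs_poly_mapping_inverse) simp
  with f show "\<exists>m\<in>exponent_box N. f = Poly_Mapping.lookup m"
    by (intro bexI[of _ "Abs_poly_mapping f"]) (auto simp: exponent_box_def)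
qed (auto simp: exponent_box_def PiE_UNIV_domain)

lemma finite_exponent_box [simp]: "finite (exponent_box N :: ('n::finite \<Rightarrow>\<^sub>0 nat) set)"
  using bij_betw_finite[OF exponent_box_bij[of N]] by (auto intro!: finite_PiE)

lemma card_exponent_box: "card (exponent_box N :: ('n::finite \<Rightarrow>\<^sub>0 nat) set) = Suc N ^ CARD('n)"
  using bij_betw_same_card[OF exponent_box_bij[of N]] by (simp add: card_PiE)

lemma zero_in_exponent_box [simp]: "0 \<in> exponent_box N"
  by (simp add: exponent_box_def)

lemma exponent_box_mono: "M \<le> N \<Longrightarrow> exponent_box M \<subseteq> exponent_box N"
  by (auto simp: exponent_box_def intro: order_trans)

lemma keys_mult_exponent_box:
  assumes "Poly_Mapping.keys p \<subseteq> exponent_box M" "Poly_Mapping.keys q \<subseteq> exponent_box N"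
  shows "Poly_Mapping.keys (p * q) \<subseteq> exponent_box (M + N)"
proof
  fix m assume "m \<in> Poly_Mapping.keys (p * q)"
  then obtain a b where "m = a + b" "a \<in> Poly_Mapping.keys p" "b \<in> Poly_Mapping.keys q"
    using keys_mult[of p q] by blast
  with assms show "m \<in> exponent_box (M + N)"
    by (auto simp: exponent_box_def lookup_add intro!: add_mono)
qed

lemma keys_power_exponent_box:
  fixes p :: "('a::comm_semiring_1, 'n) mpoly"
  assumes "Poly_Mapping.keys p \<subseteq> exponent_box M"
  shows "Poly_Mapping.keys (p ^ k) \<subseteq> exponent_box (k * M)"
proof (induction k)
  case 0
  then show ?case by simp
next
  case (Suc k)
  then show ?case using keys_mult_exponent_box[OF assms Suc] by simp
qed

lemma keys_prod_exponent_box: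
  fixes f :: "'i \<Rightarrow> ('a::comm_semiring_1, 'n) mpoly"
  assumes "\<And>i. i \<in> A \<Longrightarrow> Poly_Mapping.keys (f i) \<subseteq> exponent_box M"
  shows "Poly_Mapping.keys (prod f A) \<subseteq> exponent_box (card A * M)"
  using assms
proof (induction A rule: infinite_finite_induct)
  case (insert i A)
  then show ?case
    using keys_mult_exponent_box[of "f i" M "prod f A" "card A * M"] by simp
qed simp_all

lemma keys_subset_exponent_box:
  fixes p :: "('a::zero, 'n::finite) mpoly"
  obtains N where "Poly_Mapping.keys p \<subseteq> exponent_box N"
proof
  show "Poly_Mapping.keys p \<subseteq> exponent_box (Max (insert 0 (mon_degree ` Poly_Mapping.keys p)))"
  proof
    fix m assume m: "m \<in> Poly_Mapping.keys p"
    have "Poly_Mapping.lookup m i \<le> mon_degree m" for i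
      unfolding mon_degree_def by (rule member_le_sum) auto
    moreover have "mon_degree m \<le> Max (insert 0 (mon_degree ` Poly_Mapping.keys p))"
      using m by (intro Max_ge) auto
    ultimately show "m \<in> exponent_box (Max (insert 0 (mon_degree ` Poly_Mapping.keys p)))"
      by (auto simp: exponent_box_def intro: order_trans)
  qed
qed

lemma mp_dependent:
  fixes v :: "'i \<Rightarrow> ('a::field, 'n::finite) mpoly"
  assumes "finite I" "Suc N ^ CARD('n) < card I" "\<And>x. x \<in> I \<Longrightarrow> Poly_Mapping.keys (v x) \<subseteq> exponent_box N"
  obtains c where "\<exists>x\<in>I. c x \<noteq> 0" "(\<Sum>x\<in>I. mp_const (c x) * v x) = 0"
proof -
  interpret vector_space "\<lambda>c (p :: ('a, 'n) mpoly). mp_const c * p"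
  proof
    show "mp_const a * (mp_const b * p) = mp_const (a * b) * p" for a b and p :: "('a, 'n) mpoly"
      unfolding mult.assoc[symmetric] by (simp add: mp_const_def mult_single)
  qed (simp_all add: mp_const_def single_add algebra_simps)
  let ?T = "(\<lambda>m. Poly_Mapping.single m 1) ` exponent_box N :: ('a, 'n) mpoly set"
  have "p \<in> span ?T" if "Poly_Mapping.keys p \<subseteq> exponent_box N" for p
  proof -
    have "p = (\<Sum>m\<in>exponent_box N. mp_const (Poly_Mapping.lookup p m) * Poly_Mapping.single m 1)"
      by (intro poly_mapping_eqI)
         (use that in \<open>auto simp: mp_const_def mult_single lookup_sum lookup_single when_def in_keys_iff\<close>)
    moreover have "\<dots> \<in> span ?T"
      by (intro span_sum span_scale span_base) auto
    ultimately show ?thesis by simp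
  qed
  then have "v ` I \<subseteq> span ?T" using assms(3) by blast
  moreover have "card ?T \<le> card (exponent_box N :: ('n \<Rightarrow>\<^sub>0 nat) set)"
    by (rule card_image_le) simp
  then have "card ?T < card I"
    using assms(2) by (simp add: card_exponent_box)
  ultimately show thesis
    using family_dependent[of I ?T v] that assms(1) by auto
qed

text \<open>The products of powers of the n + 1 polynomials with exponents at most m number
  (m + 1)^(n + 1), whereas the space of polynomials containing them has a dimension growing
  like m^n.\<close>

lemma algebraic_dependence:
  fixes F :: "(complex, 'n::finite) mpoly ^ 'n" and g :: "(complex, 'n) mpoly"
  obtains N Q where "\<exists>k\<le>N. Q k \<noteq> 0"
    "\<And>z. (\<Sum>k\<le>N. mp_eval (Q k) (poly_map F z) * mp_eval g z ^ k) = 0"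
proof -
  let ?l = Poly_Mapping.lookup
  define P where "P = insert g (range (($) F))"
  have "finite P" by (simp add: P_def)
  obtain dd where dd: "\<And>p :: (complex, 'n) mpoly. Poly_Mapping.keys p \<subseteq> exponent_box (dd p)"
    using keys_subset_exponent_box by metis
  define d where "d = Max (dd ` P)"
  have d: "Poly_Mapping.keys p \<subseteq> exponent_box d" if "p \<in> P" for p
    using dd[of p] exponent_box_mono[of "dd p" d] that \<open>finite P\<close> by (auto simp: d_def)
  define D where "D = d * Suc CARD('n)"
  (* Products with exponents at most m have degree at most D * m in each variable, and for this m
     they outnumber the monomials of such degrees. *)
  define m where "m = Suc D ^ CARD('n)"
  define I where "I = (exponent_box m :: ('n \<Rightarrow>\<^sub>0 nat) set) \<times> {..m}"
  define v where "v = (\<lambda>(a, k). (\<Prod>i\<in>UNIV. (F $ i) ^ ?l a i) * g ^ k)"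
  have "Suc (D * m) ^ CARD('n) \<le> (Suc D * Suc m) ^ CARD('n)"
    by (intro power_mono) auto
  also have "\<dots> = m * Suc m ^ CARD('n)"
    by (simp only: power_mult_distrib flip: m_def)
  also have "\<dots> < Suc m * Suc m ^ CARD('n)"
    by simp
  also have "\<dots> = card I"
    by (simp add: I_def card_cartesian_product card_exponent_box)
  finally have card: "Suc (D * m) ^ CARD('n) < card I" .
  have box: "Poly_Mapping.keys (v x) \<subseteq> exponent_box (D * m)" if "x \<in> I" for x
  proof -
    obtain a k where x: "x = (a, k)" by force
    with that have ak: "\<And>i. ?l a i \<le> m" "k \<le> m"
      by (auto simp: I_def exponent_box_def)
    have "Poly_Mapping.keys (F $ i ^ ?l a i) \<subseteq> exponent_box (m * d)" for i
      using keys_power_exponent_box[OF d, of "F $ i" "?l a i"] exponent_box_mono[of "?l a i * d" "m * d"]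
        ak(1)[of i] by (auto simp: P_def)
    moreover have "Poly_Mapping.keys (g ^ k) \<subseteq> exponent_box (m * d)"
      using keys_power_exponent_box[OF d, of g k] exponent_box_mono[of "k * d" "m * d"] ak
      by (auto simp: P_def)
    ultimately have "Poly_Mapping.keys (v x) \<subseteq> exponent_box (CARD('n) * (m * d) + m * d)"
      unfolding v_def x prod.case by (intro keys_mult_exponent_box keys_prod_exponent_box)
    then show ?thesis by (simp add: D_def algebra_simps)
  qed
  obtain c where c: "\<exists>x\<in>I. c x \<noteq> 0" "(\<Sum>x\<in>I. mp_const (c x) * v x) = 0"
  proof (rule mp_dependent[OF _ card box])
    show "finite I" by (simp add: I_def)
  qed
  define Q :: "nat \<Rightarrow> (complex, 'n) mpoly"
    where "Q k = (\<Sum>a\<in>exponent_box m. Poly_Mapping.single a (c (a, k)))" for k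
  show thesis
  proof (rule that)
    from c(1) obtain a k where ak: "a \<in> exponent_box m" "k \<le> m" "c (a, k) \<noteq> 0"
      by (auto simp: I_def)
    then have "?l (Q k) a = c (a, k)"
      by (simp add: Q_def lookup_sum lookup_single when_def)
    with ak show "\<exists>k\<le>m. Q k \<noteq> 0" by (intro exI[of _ k]) auto
  next
    fix z :: "complex ^ 'n"
    have "0 = (\<Sum>x\<in>I. c x * mp_eval (v x) z)"
      using arg_cong[OF c(2), of "\<lambda>p. mp_eval p z"] by simp
    also have "\<dots> = (\<Sum>k\<le>m. \<Sum>a\<in>exponent_box m. c (a, k) * mp_eval (v (a, k)) z)"
      unfolding I_def by (subst sum.swap) (simp add: sum.cartesian_product)
    also have "\<dots> = (\<Sum>k\<le>m. mp_eval (Q k) (poly_map F z) * mp_eval g z ^ k)"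
      by (simp only: Q_def v_def prod.case mp_eval_sum mp_eval_mult mp_eval_prod mp_eval_power
          mp_eval_single mon_eval_def poly_map_nth sum_distrib_right mult.assoc)
    finally show "(\<Sum>k\<le>m. mp_eval (Q k) (poly_map F z) * mp_eval g z ^ k) = 0" by simp
  qed
qed

section \<open>Complements of hypersurfaces\<close>

lemma mp_eval_line_poly:
  fixes p :: "('a::comm_ring_1, 'n::finite) mpoly"
  shows "\<exists>q. \<forall>t. mp_eval p (\<chi> i. a $ i + t * b $ i) = poly q t"
proof (induction p rule: poly_mapping_add_induct)
  case zero
  show ?case by (intro exI[of _ 0]) simp
next
  case (single m c)
  show ?case
    by (intro exI[of _ "smult c (\<Prod>i\<in>UNIV. [:a $ i, b $ i:] ^ Poly_Mapping.lookup m i)"])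
       (simp add: mp_eval_single mon_eval_def poly_prod)
next
  case (add p q)
  then obtain q1 q2 where "\<forall>t. mp_eval p (\<chi> i. a $ i + t * b $ i) = poly q1 t"
    "\<forall>t. mp_eval q (\<chi> i. a $ i + t * b $ i) = poly q2 t" by blast
  then show ?case by (intro exI[of _ "q1 + q2"]) simp
qed

text \<open>Two points off the hypersurface lie on a complex line, which meets the convex set in a convex
  set of real dimension two and the hypersurface in finitely many points.\<close>

lemma connected_convex_diff_zeros:
  fixes V :: "(complex ^ 'n::finite) set"
  assumes "convex V" "open V" "p \<noteq> 0"
  shows "connected {z \<in> V. mp_eval p z \<noteq> 0}"
proof -
  let ?S = "{z \<in> V. mp_eval p z \<noteq> 0}"
  have "connected_component ?S a b" if a: "a \<in> ?S" and b: "b \<in> ?S" for a b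
  proof -
    define h :: "complex \<Rightarrow> complex ^ 'n" where "h t = (\<chi> i. a $ i + t * (b - a) $ i)" for t
    have cont: "continuous_on A h" for A unfolding h_def by (intro continuous_intros)
    have hconv: "h (u *\<^sub>R x + v *\<^sub>R y) = u *\<^sub>R h x + v *\<^sub>R h y" if "u + v = 1" for u v x y
    proof -
      have "a $ i + (u *\<^sub>R x + v *\<^sub>R y) * w = u *\<^sub>R (a $ i + x * w) + v *\<^sub>R (a $ i + y * w)" for i w
      proof -
        have "a $ i = u *\<^sub>R a $ i + v *\<^sub>R a $ i"
          using that by (metis scaleR_left_distrib scaleR_one)
        then show ?thesis
          by (simp add: scaleR_right_distrib distrib_right)
      qed
      then show ?thesis
        by (simp only: h_def vec_eq_iff vector_add_component vector_scaleR_component vec_lambda_beta) blast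
    qed
    have "convex (h -` V)"
      unfolding convex_def using assms(1) hconv by (simp add: convex_def)
    moreover have "open (h -` V)"
      by (rule open_vimage[OF assms(2) cont])
    moreover obtain q where q: "\<And>t. mp_eval p (h t) = poly q t"
      using mp_eval_line_poly[of p a "b - a"] unfolding h_def by blast
    have h01: "h 0 = a" "h 1 = b" by (auto simp: h_def vec_eq_iff)
    have "q \<noteq> 0" using q[of 0] a h01 by auto
    then have "finite {t. poly q t = 0}" by (rule poly_roots_finite)
    ultimately have "connected (h -` V - {t. poly q t = 0})"
      by (intro connected_open_diff_countable) (auto intro: convex_connected countable_finite)
    then have conn: "connected (h ` (h -` V - {t. poly q t = 0}))"
      by (intro connected_continuous_image cont)
    have "a \<in> h ` (h -` V - {t. poly q t = 0})"
      using a h01 q[of 0] by (intro image_eqI[of _ _ 0]) auto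
    moreover have "b \<in> h ` (h -` V - {t. poly q t = 0})"
      using b h01 q[of 1] by (intro image_eqI[of _ _ 1]) auto
    moreover have "h ` (h -` V - {t. poly q t = 0}) \<subseteq> ?S"
      using q by auto
    ultimately show ?thesis
      using conn unfolding connected_component_def by blast
  qed
  then show ?thesis by (auto simp: connected_iff_connected_component)
qed

section \<open>Volume of polynomial images\<close>

text \<open>Only permutations that fix every index outside the range of f contribute to the Leibniz sum.
  For an f that is not surjective this removes an identity block; for a bijection it is invariance
  of the determinant under relabelling.\<close>

lemma det_outside_range_trivial:
  fixes A :: "'a::comm_ring_1 ^ 'm ^ 'm" and f :: "'n::finite \<Rightarrow> 'm::finite"
  assumes f: "inj f" and A: "\<And>p q. p \<notin> range f \<Longrightarrow> A $ p $ q = (if p = q then 1 else 0)"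
  shows "det A = det (\<chi> i j. A $ f i $ f j)"
proof -
  let ?t = "\<lambda>\<pi>. of_int (sign \<pi>) * (\<Prod>p\<in>UNIV. A $ p $ \<pi> p)"
  have bij: "bij_betw f UNIV (range f)" using f by (simp add: inj_on_imp_bij_betw)
  have "det A = (\<Sum>\<pi> | \<pi> permutes range f. ?t \<pi>)"
    unfolding det_def
  proof (rule sum.mono_neutral_right)
    show "\<forall>\<pi>\<in>{\<pi>. \<pi> permutes UNIV} - {\<pi>. \<pi> permutes range f}. ?t \<pi> = 0"
    proof
      fix \<pi> :: "'m \<Rightarrow> 'm"
      assume \<pi>: "\<pi> \<in> {\<pi>. \<pi> permutes UNIV} - {\<pi>. \<pi> permutes range f}"
      then obtain p where "p \<notin> range f" "\<pi> p \<noteq> p"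
        unfolding permutes_def by auto
      then have "A $ p $ \<pi> p = 0" using A by auto
      then have "(\<Prod>p\<in>UNIV. A $ p $ \<pi> p) = 0" by (intro prod_zero) auto
      then show "?t \<pi> = 0" by simp
    qed
  qed (auto intro: permutes_subset finite_permutations)
  also have "\<dots> = (\<Sum>\<sigma> | \<sigma> permutes UNIV. ?t (map_permutation UNIV f \<sigma>))"
  proof (rule sum.reindex_bij_betw[symmetric], rule bij_betwI)
    show "map_permutation UNIV f \<in> {\<sigma>. \<sigma> permutes UNIV} \<rightarrow> {\<pi>. \<pi> permutes range f}"
      using map_permutation_permutes[OF bij] by auto
    show "map_permutation (range f) (inv f) \<in> {\<pi>. \<pi> permutes range f} \<rightarrow> {\<sigma>. \<sigma> permutes UNIV}"
      using map_permutation_permutes[OF bij_betw_inv_into[OF bij]] by auto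
    show "map_permutation (range f) (inv f) (map_permutation UNIV f \<sigma>) = \<sigma>"
      if "\<sigma> \<in> {\<sigma>. \<sigma> permutes UNIV}" for \<sigma>
      using map_permutation_compose_inv[OF bij] that f by simp
    show "map_permutation UNIV f (map_permutation (range f) (inv f) \<pi>) = \<pi>"
      if "\<pi> \<in> {\<pi>. \<pi> permutes range f}" for \<pi>
      using map_permutation_compose_inv[OF bij_betw_inv_into[OF bij]] that f
      by (auto simp: f_inv_into_f)
  qed
  also have "\<dots> = det (\<chi> i j. A $ f i $ f j)"
    unfolding det_def
  proof (rule sum.cong[OF refl])
    fix \<sigma> :: "'n \<Rightarrow> 'n" assume "\<sigma> \<in> {\<sigma>. \<sigma> permutes UNIV}"
    then have \<sigma>: "\<sigma> permutes UNIV" by simp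
    let ?\<pi> = "map_permutation UNIV f \<sigma>"
    have out: "?\<pi> p = p" if "p \<notin> range f" for p
      using map_permutation_permutes[OF bij \<sigma>] that by (rule permutes_not_in)
    have "(\<Prod>p\<in>UNIV. A $ p $ ?\<pi> p) = (\<Prod>p\<in>range f. A $ p $ ?\<pi> p)"
      by (rule prod.mono_neutral_right) (use A out in auto)
    also have "\<dots> = (\<Prod>i\<in>UNIV. A $ f i $ ?\<pi> (f i))"
      by (simp add: prod.reindex[OF f])
    also have "\<dots> = (\<Prod>i\<in>UNIV. A $ f i $ f (\<sigma> i))"
      using f by (simp add: map_permutation_apply)
    finally show "?t ?\<pi> = of_int (sign \<sigma>) * (\<Prod>i\<in>UNIV. (\<chi> i j. A $ f i $ f j) $ i $ \<sigma> i)"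
      using sign_map_permutation[OF f \<sigma>] by simp
  qed
  finally show ?thesis .
qed

lemma sum_UNIV_prod_bool:
  "(\<Sum>p\<in>(UNIV :: ('n::finite \<times> bool) set). f p) = (\<Sum>i\<in>UNIV. f (i, True) + f (i, False))"
proof -
  have "(\<Sum>p\<in>(UNIV :: ('n \<times> bool) set). f p) = (\<Sum>p\<in>(UNIV :: 'n set) \<times> (UNIV :: bool set). f p)"
    by simp
  also have "\<dots> = (\<Sum>i\<in>UNIV. \<Sum>s\<in>UNIV. f (i, s))"
    by (simp only: sum.cartesian_product')
  also have "\<dots> = (\<Sum>i\<in>UNIV. f (i, True) + f (i, False))"
    by (simp add: UNIV_bool add.commute)
  finally show ?thesis .
qed

text \<open>The matrix of a complex linear map in real coordinates: (i, True) labels the real part and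
  (i, False) the imaginary part of the i-th component.\<close>

definition realified :: "complex ^ 'n ^ 'n \<Rightarrow> real ^ ('n \<times> bool) ^ ('n::finite \<times> bool)" where
  "realified A = (\<chi> p q. if snd p = snd q then Re (A $ fst p $ fst q)
     else if snd p then - Im (A $ fst p $ fst q) else Im (A $ fst p $ fst q))"

text \<open>Over the complex numbers, passing from (Re z, Im z) to (z, conj z) conjugates the realified
  matrix to the block diagonal matrix with blocks A and conj A. Here P is this change of coordinates,
  P' its inverse and D the block diagonal matrix, which splits as D1 ** D2.\<close>

lemma det_realified:
  fixes A :: "complex ^ 'n::finite ^ 'n"
  shows "det (realified A) = (cmod (det A))\<^sup>2"
proof -
  define M :: "complex ^ ('n \<times> bool) ^ ('n \<times> bool)"
    where "M = map_matrix of_real (realified A)"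
  define P :: "complex ^ ('n \<times> bool) ^ ('n \<times> bool)" where
    "P = (\<chi> p q. if fst p = fst q then (if snd q then 1 else if snd p then \<i> else - \<i>) else 0)"
  define P' :: "complex ^ ('n \<times> bool) ^ ('n \<times> bool)" where
    "P' = (\<chi> p q. if fst p = fst q then (if snd p then 1/2 else if snd q then - \<i>/2 else \<i>/2) else 0)"
  define D1 :: "complex ^ ('n \<times> bool) ^ ('n \<times> bool)" where
    "D1 = (\<chi> p q. if snd p = snd q then (if snd p then A $ fst p $ fst q else (if fst p = fst q then 1 else 0)) else 0)"
  define D2 :: "complex ^ ('n \<times> bool) ^ ('n \<times> bool)" where
    "D2 = (\<chi> p q. if snd p = snd q then (if snd p then (if fst p = fst q then 1 else 0) else cnj (A $ fst p $ fst q)) else 0)"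
  define D :: "complex ^ ('n \<times> bool) ^ ('n \<times> bool)" where
    "D = (\<chi> p q. if snd p = snd q then (if snd p then A $ fst p $ fst q else cnj (A $ fst p $ fst q)) else 0)"
  have ext: "X = Y" if "\<And>i s j t. X $ (i, s) $ (j, t) = Y $ (i, s) $ (j, t)"
    for X Y :: "complex ^ ('n \<times> bool) ^ ('n \<times> bool)"
    using that by (simp add: vec_eq_iff)
  have d1: "(\<Sum>k\<in>UNIV. f k * (if k = j then g k else 0)) = f j * g j"
    and d2: "(\<Sum>k\<in>UNIV. (if j = k then g k else 0) * f k) = g j * f j"
    for f g :: "'n \<Rightarrow> complex" and j
    by (simp_all add: if_distrib[of "\<lambda>x. _ * x"] if_distrib[of "\<lambda>x. x * _"] cong: if_cong)
  have "D = D1 ** D2"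
  proof (rule ext)
    fix i s j t show "D $ (i, s) $ (j, t) = (D1 ** D2) $ (i, s) $ (j, t)"
      by (cases s; cases t) (simp_all add: D_def D1_def D2_def matrix_matrix_mult_def
            sum_UNIV_prod_bool d1 d2)
  qed
  moreover have "det D1 = det A"
    by (subst det_outside_range_trivial[of "\<lambda>i. (i, True)"])
       (auto simp: D1_def inj_on_def intro!: arg_cong[of _ _ det] simp: vec_eq_iff)
  moreover have "det D2 = det (\<chi> i j. cnj (A $ i $ j))"
    by (subst det_outside_range_trivial[of "\<lambda>i. (i, False)"])
       (auto simp: D2_def inj_on_def intro!: arg_cong[of _ _ det] simp: vec_eq_iff)
  moreover have "det (\<chi> i j. cnj (A $ i $ j)) = cnj (det A)"
    by (simp add: det_def)
  ultimately have D: "det D = det A * cnj (det A)"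
    by (simp add: det_mul)
  have "P ** M = D ** P"
  proof (rule ext)
    fix i s j t show "(P ** M) $ (i, s) $ (j, t) = (D ** P) $ (i, s) $ (j, t)"
      by (cases s; cases t) (simp_all add: P_def M_def D_def realified_def map_matrix_def
            matrix_matrix_mult_def sum_UNIV_prod_bool sum.distrib d1 d2 complex_eq_iff)
  qed
  then have eq: "det P * det M = det D * det P" by (metis det_mul)
  have "P ** P' = mat 1"
  proof (rule ext)
    fix i s j t show "(P ** P') $ (i, s) $ (j, t) = mat 1 $ (i, s) $ (j, t)"
      by (cases s; cases t) (simp_all add: P_def P'_def mat_def matrix_matrix_mult_def
            sum_UNIV_prod_bool sum.distrib d1 d2)
  qed
  then have "det P * det P' = 1" by (metis det_mul det_I)
  then have "det P \<noteq> 0" by auto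
  with eq D have "det M = det A * cnj (det A)" by (simp add: mult.commute)
  also have "\<dots> = of_real ((cmod (det A))\<^sup>2)"
    by (simp only: complex_norm_square)
  also have "det M = of_real (det (realified A))"
    by (simp add: M_def det_def map_matrix_def)
  finally show ?thesis by (simp only: of_real_eq_iff)
qed

text \<open>The real coordinates are relabelled by a well-ordered type with 2 CARD('n) elements, because the
  change of variables theorem is about such index types.\<close>

definition real_index :: "'n::finite \<times> bool \<Rightarrow> 'n bit0" where
  "real_index = (SOME f. bij f)"

lemma bij_real_index: "bij (real_index :: 'n::finite \<times> bool \<Rightarrow> 'n bit0)"
proof -
  have "card (UNIV :: ('n \<times> bool) set) = card (UNIV :: 'n bit0 set)"
    by (simp add: UNIV_bool flip: UNIV_Times_UNIV)
  then have "\<exists>f :: 'n \<times> bool \<Rightarrow> 'n bit0. bij f"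
    by (intro finite_same_card_bij) auto
  then show ?thesis
    unfolding real_index_def by (rule someI_ex)
qed

definition real_vec :: "complex ^ 'n \<Rightarrow> real ^ ('n::finite bit0)" where
  "real_vec z = (\<chi> p. if snd (inv real_index p) then Re (z $ fst (inv real_index p))
                       else Im (z $ fst (inv real_index p)))"

definition complex_vec :: "real ^ ('n::finite bit0) \<Rightarrow> complex ^ 'n" where
  "complex_vec x = (\<chi> i. Complex (x $ real_index (i, True)) (x $ real_index (i, False)))"

lemma inv_real_index [simp]: "inv real_index (real_index p) = p"
  by (rule inv_f_f[OF bij_is_inj[OF bij_real_index]])

lemma real_vec_nth [simp]: "real_vec z $ real_index (i, s) = (if s then Re (z $ i) else Im (z $ i))"
  by (simp add: real_vec_def)

lemma real_index_cases: obtains i s where "p = real_index (i, s)"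
  using bij_real_index by (metis bij_pointE surj_pair)

lemma complex_vec_real_vec [simp]: "complex_vec (real_vec z) = z"
  by (simp add: complex_vec_def vec_eq_iff)

lemma real_vec_complex_vec [simp]: "real_vec (complex_vec x) = x"
proof (subst vec_eq_iff, intro allI)
  fix p show "real_vec (complex_vec x) $ p = x $ p"
    by (cases p rule: real_index_cases) (simp add: complex_vec_def)
qed

lemma linear_real_vec: "linear real_vec"
  by (intro linearI) (auto simp: real_vec_def vec_eq_iff)

lemma linear_complex_vec: "linear complex_vec"
  by (intro linearI) (auto simp: complex_vec_def vec_eq_iff complex_eq_iff)

lemma prod_real_index:
  "(\<Prod>p\<in>UNIV. f (fst (inv real_index p))) = (\<Prod>i\<in>(UNIV :: 'n::finite set). f i ^ 2)"
proof -
  have "(\<Prod>p\<in>UNIV. f (fst (inv real_index p))) = (\<Prod>q\<in>(UNIV :: ('n \<times> bool) set). f (fst q))"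
    using prod.reindex_bij_betw[OF bij_real_index, of "\<lambda>p. f (fst (inv real_index p))"]
    by simp
  also have "\<dots> = (\<Prod>q\<in>(UNIV :: 'n set) \<times> (UNIV :: bool set). f (fst q))" by simp
  also have "\<dots> = (\<Prod>i\<in>(UNIV :: 'n set). \<Prod>s\<in>(UNIV :: bool set). f i)"
    by (simp only: prod.cartesian_product' fst_conv)
  also have "\<dots> = (\<Prod>i\<in>(UNIV :: 'n set). f i ^ 2)"
    by (simp add: UNIV_bool power2_eq_square)
  finally show ?thesis .
qed

definition complex_box :: "complex ^ 'n \<Rightarrow> ('n \<Rightarrow> real) \<Rightarrow> (complex ^ 'n::finite) set" where
  "complex_box c b = {z. \<forall>i. \<bar>Re (z $ i - c $ i)\<bar> \<le> b i \<and> \<bar>Im (z $ i - c $ i)\<bar> \<le> b i}"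

lemma real_vec_complex_box:
  fixes c :: "complex ^ 'n::finite"
  shows "real_vec ` complex_box c b = cbox (real_vec c - (\<chi> p. b (fst (inv real_index p))))
                                     (real_vec c + (\<chi> p. b (fst (inv real_index p))))"
    (is "_ = ?C")
proof -
  have *: "real_vec z \<in> ?C \<longleftrightarrow> z \<in> complex_box c b" for z
  proof -
    have all: "(\<forall>p. Q p) \<longleftrightarrow> (\<forall>i s. Q (real_index (i, s)))" for Q :: "'n bit0 \<Rightarrow> bool"
      by (metis real_index_cases)
    have "real_vec z \<in> ?C \<longleftrightarrow> (\<forall>i s. \<bar>real_vec z $ real_index (i, s) - real_vec c $ real_index (i, s)\<bar> \<le> b i)"
      unfolding mem_box_cart all
      by (simp only: vector_minus_component vector_add_component vec_lambda_beta
            inv_real_index fst_conv abs_diff_le_iff)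
    then show ?thesis by (auto simp: complex_box_def all_bool_eq)
  qed
  show ?thesis
  proof (intro set_eqI iffI)
    fix x assume "x \<in> ?C"
    then have "complex_vec x \<in> complex_box c b"
      using *[of "complex_vec x"] by (simp only: real_vec_complex_vec)
    then show "x \<in> real_vec ` complex_box c b"
      by (intro image_eqI[of _ _ "complex_vec x"]) simp_all
  qed (use * in auto)
qed

lemma measure_complex_box:
  assumes "\<And>i. 0 \<le> b i"
  shows "measure lebesgue (real_vec ` complex_box c b) = (\<Prod>i\<in>UNIV. 2 * b i) ^ 2"
proof -
  have "measure lebesgue (real_vec ` complex_box c b) = (\<Prod>p\<in>UNIV. 2 * b (fst (inv real_index p)))"
    unfolding real_vec_complex_box
    using assms
    by (subst measure_completion, simp, subst content_cbox_if_cart)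
       (simp_all add: interval_eq_empty_cart assms[THEN leD])
  also have "\<dots> = (\<Prod>i\<in>UNIV. 2 * b i) ^ 2"
    unfolding prod_real_index[of "\<lambda>i. 2 * b i"] by (simp add: prod_power_distrib)
  finally show ?thesis .
qed

lemma det_matrix_real_vec:
  fixes A :: "complex ^ 'n::finite ^ 'n"
  shows "det (matrix (real_vec \<circ> (*v) A \<circ> complex_vec)) = (cmod (det A))\<^sup>2"
proof -
  have "complex_vec (axis (real_index (j, t)) 1) = axis j (if t then 1 else \<i>)" for j :: 'n and t
    by (auto simp: complex_vec_def vec_eq_iff axis_def complex_eq_iff bij_is_inj[OF bij_real_index, THEN inj_eq])
  moreover have "(A *v axis j c) $ i = A $ i $ j * c" for i j c
    by (simp add: matrix_vector_mult_def axis_def if_distrib[of "\<lambda>x. _ * x"] cong: if_cong)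
  ultimately have "matrix (real_vec \<circ> (*v) A \<circ> complex_vec) $ real_index P $ real_index Q = realified A $ P $ Q" for P Q
    by (cases P; cases Q)
       (simp add: matrix_def realified_def)
  then show ?thesis
    using det_outside_range_trivial[OF bij_is_inj[OF bij_real_index],
        of "matrix (real_vec \<circ> (*v) A \<circ> complex_vec)"]
    by (simp add: bij_is_surj[OF bij_real_index] det_realified)
qed

text \<open>The change of variables inequality. The real Jacobian is the square of the absolute value of the
  complex one and the volume of a box is the square of the product of its side lengths, so that
  taking square roots leaves no exponents.\<close>

lemma poly_map_volume_bound:
  fixes F :: "(complex, 'n::finite) mpoly ^ 'n"
  assumes K: "compact K" "K \<subseteq> complex_box 0 a"
    and B: "0 \<le> B" "\<And>z. z \<in> K \<Longrightarrow> cmod (mp_eval (det (mp_jacobian F)) z) \<le> B"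
    and b: "complex_box c b \<subseteq> poly_map F ` K" "\<And>i. 0 \<le> a i" "\<And>i. 0 \<le> b i"
  shows "(\<Prod>i\<in>UNIV. b i) \<le> B * (\<Prod>i\<in>UNIV. a i)"
proof -
  define S where "S = real_vec ` K"
  define f where "f = real_vec \<circ> poly_map F \<circ> complex_vec"
  define f' where "f' x = real_vec \<circ> (*v) (jacobian_at F (complex_vec x)) \<circ> complex_vec" for x
  have fS: "f ` S = real_vec ` poly_map F ` K"
    by (simp add: f_def S_def image_image)
  have contr: "continuous_on T (real_vec :: complex ^ 'n \<Rightarrow> _)" for T
    by (simp add: linear_real_vec linear_continuous_on linear_linear)
  have contc: "continuous_on T (complex_vec :: _ \<Rightarrow> complex ^ 'n)" for T
    by (simp add: linear_complex_vec linear_continuous_on linear_linear)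
  have S: "compact S"
    unfolding S_def by (intro compact_continuous_image contr K)
  have det: "\<bar>det (matrix (f' x))\<bar> = (cmod (mp_eval (det (mp_jacobian F)) (complex_vec x)))\<^sup>2" for x
    unfolding f'_def det_matrix_real_vec by (simp add: mp_eval_det)
  have deriv: "(f has_derivative f' x) (at x within S)" for x
    unfolding f_def f'_def o_assoc
    by (intro diff_chain_within has_derivative_poly_map linear_imp_has_derivative
          linear_real_vec linear_complex_vec)
  have "continuous_on S (\<lambda>x. \<bar>det (matrix (f' x))\<bar>)"
    unfolding det by (intro continuous_intros contc)
  then have "set_integrable lborel S (\<lambda>x. \<bar>det (matrix (f' x))\<bar>)"
    unfolding set_integrable_def by (rule borel_integrable_compact[OF S])
  then have int: "(\<lambda>x. \<bar>det (matrix (f' x))\<bar>) integrable_on S"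
    by (rule set_borel_integral_eq_integral(1))
  have "measure lebesgue (real_vec ` complex_box c b) \<le> measure lebesgue (f ` S)"
  proof (rule measure_mono_fmeasurable)
    show "real_vec ` complex_box c b \<subseteq> f ` S"
      using b(1) unfolding fS by blast
    show "f ` S \<in> lmeasurable"
      unfolding fS by (intro lmeasurable_compact compact_continuous_image contr K
          continuous_on_poly_map[OF continuous_on_id])
    show "real_vec ` complex_box c b \<in> sets lebesgue"
      unfolding real_vec_complex_box by simp
  qed
  also have "\<dots> \<le> B\<^sup>2 * measure lebesgue S"
  proof (rule measure_bounded_differentiable_image[OF _ deriv int])
    show "S \<in> lmeasurable" using S by (rule lmeasurable_compact)
    show "\<bar>det (matrix (f' x))\<bar> \<le> B\<^sup>2" if "x \<in> S" for x
      unfolding det using that B by (auto simp: S_def intro!: power_mono)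
  qed
  also have "\<dots> \<le> B\<^sup>2 * measure lebesgue (real_vec ` complex_box (0 :: complex ^ 'n) a)"
  proof (intro mult_left_mono measure_mono_fmeasurable)
    show "S \<subseteq> real_vec ` complex_box 0 a" using K by (auto simp: S_def)
    show "S \<in> sets lebesgue" using lmeasurable_compact[OF S] by (rule fmeasurableD)
    show "real_vec ` complex_box (0 :: complex ^ 'n) a \<in> lmeasurable"
      unfolding real_vec_complex_box by simp
  qed auto
  finally have "(\<Prod>i\<in>UNIV. 2 * b i) ^ 2 \<le> (B * (\<Prod>i\<in>UNIV. 2 * a i)) ^ 2"
    using b by (simp add: measure_complex_box power_mult_distrib)
  then have "(\<Prod>i\<in>UNIV. 2 * b i) \<le> B * (\<Prod>i\<in>UNIV. 2 * a i)"
  proof (rule power2_le_imp_le)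
    show "0 \<le> B * (\<Prod>i\<in>UNIV. 2 * a i)"
      using B(1) b(2) by (intro mult_nonneg_nonneg prod_nonneg) auto
  qed
  then show ?thesis
    by (simp add: prod.distrib)
qed

section \<open>Regular values\<close>

lemma closure_nonzeros:
  fixes p :: "('a::real_normed_field, 'n::finite) mpoly"
  assumes "p \<noteq> 0"
  shows "closure {x. mp_eval p x \<noteq> 0} = UNIV"
proof -
  have "open (- closure {x. mp_eval p x \<noteq> 0})" by (simp add: open_Compl)
  moreover have "mp_eval p x = 0" if "x \<in> - closure {x. mp_eval p x \<noteq> 0}" for x
    using that closure_subset[of "{x. mp_eval p x \<noteq> 0}"] by auto
  ultimately have "- closure {x. mp_eval p x \<noteq> 0} = {}"
    using mp_eval_open_eq_0[of "- closure {x. mp_eval p x \<noteq> 0}" p] assms by blast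
  then show ?thesis by blast
qed

lemma isCont_mp_eval: "isCont (mp_eval p) (x :: 'a::real_normed_field ^ 'n::finite)"
  using has_derivative_mp_eval has_derivative_continuous by blast

text \<open>F and its Jacobian determinant J are algebraically dependent. Dividing the relation by the highest
  power of J that divides all its terms leaves a relation whose constant coefficient is nonzero;
  this coefficient, evaluated at F, vanishes wherever J does.\<close>

lemma critical_values_hypersurface:
  fixes F :: "(complex, 'n::finite) mpoly ^ 'n"
  assumes J: "det (mp_jacobian F) \<noteq> 0"
  obtains D where "D \<noteq> 0"
    "\<And>z. mp_eval (det (mp_jacobian F)) z = 0 \<Longrightarrow> mp_eval D (poly_map F z) = 0"
proof -
  let ?J = "det (mp_jacobian F)"
  obtain N Q where Q: "\<exists>k\<le>N. Q k \<noteq> 0"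
    "\<And>z. (\<Sum>k\<le>N. mp_eval (Q k) (poly_map F z) * mp_eval ?J z ^ k) = 0"
    using algebraic_dependence[of F ?J] by blast
  define l where "l = (LEAST k. Q k \<noteq> 0)"
  have l: "Q l \<noteq> 0" "l \<le> N" "\<And>k. k < l \<Longrightarrow> Q k = 0"
    using Q(1) unfolding l_def by (auto intro: LeastI2 Least_le[THEN order_trans] dest: not_less_Least LeastI)
  (* r is the relation divided by J ^ l; it vanishes off J = 0 and, by density, everywhere. *)
  define r where "r z = (\<Sum>k=l..N. mp_eval (Q k) (poly_map F z) * mp_eval ?J z ^ (k - l))" for z
  have "r z = 0" if "mp_eval ?J z \<noteq> 0" for z
  proof -
    have "0 = (\<Sum>k\<le>N. mp_eval (Q k) (poly_map F z) * mp_eval ?J z ^ k)"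
      using Q(2) by simp
    also have "\<dots> = (\<Sum>k=l..N. mp_eval (Q k) (poly_map F z) * mp_eval ?J z ^ k)"
      by (rule sum.mono_neutral_right) (use l in \<open>auto simp: not_le\<close>)
    also have "\<dots> = mp_eval ?J z ^ l * r z"
      unfolding r_def sum_distrib_left
      by (rule sum.cong) (auto simp: mult_ac simp flip: power_add)
    finally show ?thesis using that by simp
  qed
  moreover have "continuous_on (closure {z. mp_eval ?J z \<noteq> 0}) r"
    unfolding r_def by (intro continuous_intros)
  ultimately have r: "r z = 0" for z
    using continuous_constant_on_closure[of "{z. mp_eval ?J z \<noteq> 0}" r 0 z] closure_nonzeros[OF J]
    by auto
  have "mp_eval (Q l) (poly_map F z) = 0" if "mp_eval ?J z = 0" for z
  proof -
    have "0 = (\<Sum>k=l..N. mp_eval (Q k) (poly_map F z) * 0 ^ (k - l))"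
      using r[of z] that by (simp add: r_def)
    also have "\<dots> = (\<Sum>k\<in>{l}. mp_eval (Q k) (poly_map F z) * 0 ^ (k - l))"
      by (rule sum.mono_neutral_right) (use l(2) in auto)
    finally show ?thesis by simp
  qed
  with l(1) show thesis using that by blast
qed

text \<open>F and the coordinate function z $ j are algebraically dependent. Where the leading coefficient
  Q N does not vanish, the relation confines z $ j on the fibres of F.\<close>

lemma coordinate_algebraic_equation:
  fixes F :: "(complex, 'n::finite) mpoly ^ 'n"
  obtains N Q where "Q N \<noteq> 0"
    "\<And>z. (\<Sum>k\<le>N. mp_eval (Q k) (poly_map F z) * (z $ j) ^ k) = 0"
proof -
  obtain N Q where Q: "\<exists>k\<le>N. Q k \<noteq> 0"
    "\<And>z. (\<Sum>k\<le>N. mp_eval (Q k) (poly_map F z) *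
       mp_eval (Poly_Mapping.single (Poly_Mapping.single j 1) 1) z ^ k) = 0"
    using algebraic_dependence[of F "Poly_Mapping.single (Poly_Mapping.single j 1) 1"] by blast
  have X: "mp_eval (Poly_Mapping.single (Poly_Mapping.single j 1) 1) z = z $ j" for z :: "complex ^ 'n"
    by (simp add: mp_eval_single mon_eval_def lookup_single when_def if_distrib[of "\<lambda>k. _ ^ k"] cong: if_cong)
  define M where "M = Max {k. k \<le> N \<and> Q k \<noteq> 0}"
  have "M \<in> {k. k \<le> N \<and> Q k \<noteq> 0}"
    unfolding M_def by (rule Max_in) (use Q(1) in auto)
  then have M: "M \<le> N" "Q M \<noteq> 0" by auto
  have gt: "Q k = 0" if "M < k" "k \<le> N" for k
    using that Max_ge[of "{k. k \<le> N \<and> Q k \<noteq> 0}" k] unfolding M_def by fastforce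
  show thesis
  proof (rule that[of Q M])
    show "(\<Sum>k\<le>M. mp_eval (Q k) (poly_map F z) * (z $ j) ^ k) = 0" for z
    proof -
      have "(\<Sum>k\<le>M. mp_eval (Q k) (poly_map F z) * (z $ j) ^ k) =
          (\<Sum>k\<le>N. mp_eval (Q k) (poly_map F z) * (z $ j) ^ k)"
        by (rule sum.mono_neutral_left) (use M gt in \<open>auto simp: not_le\<close>)
      then show ?thesis using Q(2)[of z] unfolding X by simp
    qed
  qed (rule M)
qed

lemma root_bound:
  fixes c :: "nat \<Rightarrow> complex"
  assumes "(\<Sum>k\<le>N. c k * t ^ k) = 0"
  shows "cmod (c N) * cmod t \<le> cmod (c N) + (\<Sum>k<N. cmod (c k))"
proof (cases "cmod t \<le> 1")
  case True
  then have "cmod (c N) * cmod t \<le> cmod (c N)"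
    by (simp add: mult_left_le)
  also have "\<dots> \<le> cmod (c N) + (\<Sum>k<N. cmod (c k))"
    by (simp add: sum_nonneg)
  finally show ?thesis .
next
  case False
  show ?thesis
  proof (cases N)
    case 0
    then show ?thesis using assms by simp
  next
    case (Suc n)
    have "c N * t ^ N = - (\<Sum>k<N. c k * t ^ k)"
      using assms by (simp add: lessThan_Suc_atMost[symmetric] add_eq_0_iff2)
    then have "cmod (c N) * cmod t ^ N = cmod (\<Sum>k<N. c k * t ^ k)"
      by (metis norm_minus_cancel norm_mult norm_power)
    also have "\<dots> \<le> (\<Sum>k<N. cmod (c k) * cmod t ^ k)"
      by (rule sum_norm_le) (simp add: norm_mult norm_power)
    also have "\<dots> \<le> (\<Sum>k<N. cmod (c k) * cmod t ^ n)"
      by (intro sum_mono mult_left_mono power_increasing) (use False Suc in auto)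
    finally have "(cmod (c N) * cmod t) * cmod t ^ n \<le> (\<Sum>k<N. cmod (c k)) * cmod t ^ n"
      by (simp only: Suc sum_distrib_right mult.assoc power_Suc)
    then have "cmod (c N) * cmod t \<le> (\<Sum>k<N. cmod (c k))"
      by (rule mult_right_le_imp_le) (rule zero_less_power, use False in linarith)
    then show ?thesis by (simp add: add_increasing)
  qed
qed

text \<open>Off the zeros of D the image of an open set is open, since all critical values are zeros of D. If
  it is also closed there, connectedness makes it everything.\<close>

lemma poly_map_image_clopen:
  fixes F :: "(complex, 'n::finite) mpoly ^ 'n"
  assumes crit: "\<And>z. mp_eval (det (mp_jacobian F)) z = 0 \<Longrightarrow> mp_eval D (poly_map F z) = 0"
    and "D \<noteq> 0" "convex V" "open V" "open S"
    and closed: "closedin (top_of_set {w \<in> V. mp_eval D w \<noteq> 0}) (poly_map F ` S \<inter> {w \<in> V. mp_eval D w \<noteq> 0})"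
    and ne: "poly_map F ` S \<inter> {w \<in> V. mp_eval D w \<noteq> 0} \<noteq> {}"
  shows "{w \<in> V. mp_eval D w \<noteq> 0} \<subseteq> poly_map F ` S"
proof -
  let ?V = "{w \<in> V. mp_eval D w \<noteq> 0}" and ?I = "poly_map F ` S"
  have "w \<in> interior ?I" if w: "w \<in> ?I \<inter> ?V" for w
  proof -
    obtain z where "z \<in> S" "w = poly_map F z" using w by blast
    moreover from this w have "mp_eval (det (mp_jacobian F)) z \<noteq> 0" using crit[of z] by auto
    ultimately show ?thesis using poly_map_interior_image[of F z S] \<open>open S\<close> by simp
  qed
  then have eq: "?I \<inter> ?V = ?V \<inter> interior ?I"
    using interior_subset[of ?I] by blast
  have "openin (top_of_set ?V) (?I \<inter> ?V)"
    unfolding eq by (intro openin_open_Int open_interior)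
  moreover have "connected ?V" by (rule connected_convex_diff_zeros) fact+
  ultimately have "?I \<inter> ?V = ?V"
    using closed ne unfolding connected_clopen by blast
  then show ?thesis by blast
qed

lemma norm_vec_le_sum: "norm (z :: complex ^ 'n::finite) \<le> (\<Sum>i\<in>UNIV. cmod (z $ i))"
  unfolding norm_vec_def by (rule L2_set_le_sum) simp

definition polydisc :: "('n \<Rightarrow> real) \<Rightarrow> (complex ^ 'n::finite) set" where
  "polydisc r = {z. \<forall>i. cmod (z $ i) \<le> r i}"

lemma compact_polydisc: "compact (polydisc r)"
proof -
  have "norm z \<le> (\<Sum>i\<in>UNIV. r i)" if "z \<in> polydisc r" for z
    using that by (intro order_trans[OF norm_vec_le_sum] sum_mono) (auto simp: polydisc_def)
  then have "bounded (polydisc r)" by (rule boundedI)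
  moreover have "closed (polydisc r)"
    unfolding polydisc_def by (intro closed_Collect_all closed_Collect_le continuous_intros)
  ultimately show ?thesis by (simp add: compact_eq_bounded_closed)
qed

text \<open>Where no critical value lies and no leading coefficient of the coordinate equations vanishes,
  F is proper by \<^emph>\<open>root_bound\<close>, so its image is closed there as well as open.\<close>

lemma poly_map_generic_values:
  fixes F :: "(complex, 'n::finite) mpoly ^ 'n"
  assumes J: "det (mp_jacobian F) \<noteq> 0"
  obtains D where "D \<noteq> 0"
    "\<And>z. mp_eval (det (mp_jacobian F)) z = 0 \<Longrightarrow> mp_eval D (poly_map F z) = 0"
    "\<And>w. mp_eval D w \<noteq> 0 \<Longrightarrow> w \<in> range (poly_map F)"
proof -
  obtain D0 where D0: "D0 \<noteq> 0"
    "\<And>z. mp_eval (det (mp_jacobian F)) z = 0 \<Longrightarrow> mp_eval D0 (poly_map F z) = 0"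
    using critical_values_hypersurface[OF J] by blast
  have "\<exists>N Q. Q N \<noteq> 0 \<and> (\<forall>z. (\<Sum>k\<le>N. mp_eval (Q k) (poly_map F z) * (z $ j) ^ k) = 0)" for j
    using coordinate_algebraic_equation[of F j] by metis
  then obtain N Q where Q: "\<And>j. Q j (N j) \<noteq> (0 :: (complex, 'n) mpoly)"
    "\<And>j z. (\<Sum>k\<le>N j. mp_eval (Q j k) (poly_map F z) * (z $ j) ^ k) = 0"
    by metis
  define D where "D = D0 * (\<Prod>j\<in>UNIV. Q j (N j))"
  have D: "D \<noteq> 0"
    unfolding D_def using mp_mult_eq_0[of D0] mp_prod_nonzero[of UNIV "\<lambda>j. Q j (N j)"] D0(1) Q(1)
    by blast
  have crit: "mp_eval D (poly_map F z) = 0" if "mp_eval (det (mp_jacobian F)) z = 0" for z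
    using D0(2)[OF that] by (simp add: D_def)
  let ?V = "{w \<in> UNIV. mp_eval D w \<noteq> 0}" and ?I = "range (poly_map F)"
  define h where "h j w = 1 + (\<Sum>k<N j. cmod (mp_eval (Q j k) w)) / cmod (mp_eval (Q j (N j)) w)" for j w
  have Dne: "mp_eval (Q j (N j)) w \<noteq> 0" if "mp_eval D w \<noteq> 0" for j w
    using that by (auto simp: D_def prod_zero_iff)
  have h: "cmod (z $ j) \<le> h j (poly_map F z)" if "mp_eval D (poly_map F z) \<noteq> 0" for j z
    using root_bound[OF Q(2), of j z] Dne[OF that, of j] by (simp add: h_def field_simps)
  have "closedin (top_of_set ?V) (?I \<inter> ?V)"
    unfolding closedin_limpt
  proof (intro conjI allI impI)
    fix l assume "l islimpt (?I \<inter> ?V) \<and> l \<in> ?V"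
    then obtain w where w: "\<And>n. w n \<in> ?I" "\<And>n. mp_eval D (w n) \<noteq> 0" "w \<longlonglongrightarrow> l" "mp_eval D l \<noteq> 0"
      unfolding islimpt_sequential by blast
    have "\<forall>n. \<exists>z. w n = poly_map F z" using w(1) by blast
    then obtain z where z: "\<And>n. w n = poly_map F (z n)" by metis
    have "convergent (\<lambda>n. h j (w n))" for j
    proof (rule convergentI)
      have "isCont (h j) l"
        unfolding h_def using Dne[OF w(4)]
        by (intro continuous_intros isCont_mp_eval) auto
      then show "(\<lambda>n. h j (w n)) \<longlonglongrightarrow> h j l"
        using w(3) by (rule isCont_tendsto_compose)
    qed
    then have bdd: "\<exists>M. \<forall>n. h j (w n) \<le> M" for j
      using convergent_imp_Bseq[of "\<lambda>n. h j (w n)"] unfolding Bseq_def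
      by (auto dest: abs_le_D1)
    define M where "M j = (SOME M. \<forall>n. h j (w n) \<le> M)" for j
    have M: "h j (w n) \<le> M j" for j n
      using someI_ex[OF bdd[of j]] by (simp add: M_def)
    have "cmod (z n $ j) \<le> M j" for n j
      using order_trans[OF h[of "z n" j, folded z, OF w(2)] M] .
    then have "z n \<in> polydisc M" for n
      by (simp add: polydisc_def)
    then obtain x r where xr: "strict_mono r" "(z \<circ> r) \<longlonglongrightarrow> x"
      using compact_polydisc[of M] unfolding compact_def by metis
    have "isCont (poly_map F) x"
      using has_derivative_poly_map has_derivative_continuous by blast
    then have "(\<lambda>n. poly_map F ((z \<circ> r) n)) \<longlonglongrightarrow> poly_map F x"
      using xr(2) by (rule isCont_tendsto_compose)
    moreover have "(\<lambda>n. poly_map F ((z \<circ> r) n)) \<longlonglongrightarrow> l"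
      using LIMSEQ_subseq_LIMSEQ[OF w(3) xr(1)] z by (simp add: o_def)
    ultimately have "l = poly_map F x" using LIMSEQ_unique by blast
    with w(4) show "l \<in> ?I \<inter> ?V" by auto
  qed auto
  moreover obtain z where "mp_eval D (poly_map F z) \<noteq> 0"
    by (rule poly_map_dominant[OF J D])
  then have "?I \<inter> ?V \<noteq> {}" by blast
  ultimately have "?V \<subseteq> ?I"
    using crit by (intro poly_map_image_clopen[OF _ D convex_UNIV open_UNIV open_UNIV]) blast+
  with D crit show thesis by (intro that[of D]) auto
qed

section \<open>Weighted properness forces a large Jacobian\<close>

definition weighted_polydisc :: "nat ^ 'n \<Rightarrow> real \<Rightarrow> (complex ^ 'n::finite) set" where
  "weighted_polydisc \<omega> R = polydisc (\<lambda>i. R ^ (\<omega> $ i))"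

lemma wrho_boundary:
  assumes \<omega>: "\<And>i. 0 < \<omega> $ i" and R: "1 \<le> R"
    and z: "z \<in> weighted_polydisc \<omega> R" "cmod (z $ j) = R ^ (\<omega> $ j)"
  shows "wrho \<omega> z = R"
proof -
  have root: "(R ^ (\<omega> $ i)) powr (1 / real (\<omega> $ i)) = R" for i
    using \<omega>[of i] R by (simp add: powr_powr flip: powr_realpow)
  show ?thesis
    unfolding wrho_def
  proof (rule Max_eqI)
    have "R = cmod (z $ j) powr (1 / real (\<omega> $ j))" using root[of j] z(2) by simp
    then show "R \<in> insert 1 (range (\<lambda>i. cmod (z $ i) powr (1 / real (\<omega> $ i))))" by blast
    fix y assume "y \<in> insert 1 (range (\<lambda>i. cmod (z $ i) powr (1 / real (\<omega> $ i))))"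
    then consider "y = 1" | i where "y = cmod (z $ i) powr (1 / real (\<omega> $ i))" by auto
    then show "y \<le> R"
    proof cases
      case 2
      have "cmod (z $ i) powr (1 / real (\<omega> $ i)) \<le> (R ^ (\<omega> $ i)) powr (1 / real (\<omega> $ i))"
        using z(1) by (intro powr_mono2) (auto simp: weighted_polydisc_def polydisc_def)
      with 2 root[of i] show ?thesis by simp
    qed (use R in simp)
  qed auto
qed

lemma mp_eval_weighted_bound:
  fixes p :: "(complex, 'n::finite) mpoly"
  assumes "p \<noteq> 0"
  obtains C d where "0 \<le> C" "wdeg \<omega> p = ereal (real d)"
    "\<And>R z. 1 \<le> R \<Longrightarrow> z \<in> weighted_polydisc \<omega> R \<Longrightarrow> cmod (mp_eval p z) \<le> C * R ^ d"
proof -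
  let ?l = Poly_Mapping.lookup and ?K = "Poly_Mapping.keys p"
  define wt :: "('n \<Rightarrow>\<^sub>0 nat) \<Rightarrow> nat" where "wt m = (\<Sum>i\<in>UNIV. \<omega> $ i * ?l m i)" for m
  define d where "d = Max (wt ` ?K)"
  define C where "C = (\<Sum>m\<in>?K. cmod (?l p m))"
  have ne: "?K \<noteq> {}" using assms by simp
  have le: "wt m \<le> d" if "m \<in> ?K" for m
    unfolding d_def using that by (intro Max_ge) auto
  have "d \<in> wt ` ?K"
    unfolding d_def using ne by (intro Max_in) auto
  then obtain m0 where m0: "m0 \<in> ?K" "d = wt m0" by blast
  have "wdeg \<omega> p = ereal (real d)"
    unfolding wdeg_def wt_def[symmetric]
    by (rule antisym) (use le m0 in \<open>auto intro!: SUP_least intro: SUP_upper\<close>)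
  moreover have "0 \<le> C" by (simp add: C_def sum_nonneg)
  moreover have "cmod (mp_eval p z) \<le> C * R ^ d"
    if R: "1 \<le> R" and z: "z \<in> weighted_polydisc \<omega> R" for R z
  proof -
    have mon: "cmod (mon_eval m z) \<le> R ^ d" if "m \<in> ?K" for m
    proof -
      have "cmod (mon_eval m z) = (\<Prod>i\<in>UNIV. cmod (z $ i) ^ ?l m i)"
        by (simp add: mon_eval_def norm_power flip: prod_norm)
      also have "\<dots> \<le> (\<Prod>i\<in>UNIV. (R ^ (\<omega> $ i)) ^ ?l m i)"
        using z by (intro prod_mono conjI power_mono) (auto simp: weighted_polydisc_def polydisc_def)
      also have "\<dots> = R ^ wt m"
        by (simp add: wt_def power_sum flip: power_mult)
      also have "\<dots> \<le> R ^ d"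
        using le[OF that] R by (intro power_increasing) auto
      finally show ?thesis .
    qed
    have "cmod (mp_eval p z) \<le> (\<Sum>m\<in>?K. cmod (?l p m * mon_eval m z))"
      unfolding mp_eval_superset[OF finite_keys order_refl] by (rule norm_sum)
    also have "\<dots> \<le> (\<Sum>m\<in>?K. cmod (?l p m) * R ^ d)"
      by (intro sum_mono) (simp add: norm_mult mult_left_mono mon)
    finally show ?thesis by (simp add: C_def sum_distrib_right)
  qed
  ultimately show thesis by (intro that[of C d]) auto
qed

text \<open>On the boundary of the weighted polydisc F stays away from the box W of twice the size, so the
  images of the closed polydisc and of its interior have the same trace on W. This trace is closed
  in W, and off the zeros of D it is open, hence it is everything; the zeros of D are filled in by
  closedness. The factor 4 in the last hypothesis is 2 for the size of W and 2 for estimating a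
  complex number by its real and imaginary parts.\<close>

lemma weighted_proper_image_covers_box:
  fixes F :: "(complex, 'n::finite) mpoly ^ 'n"
  assumes crit: "\<And>z. mp_eval (det (mp_jacobian F)) z = 0 \<Longrightarrow> mp_eval D (poly_map F z) = 0"
    and \<omega>: "\<And>i. 0 < \<omega> $ i" and R: "1 \<le> R"
    and z0: "\<And>i. cmod (z0 $ i) < R ^ (\<omega> $ i)" "mp_eval D (poly_map F z0) \<noteq> 0"
    and b: "\<And>i. 0 < b i"
    and bd: "\<And>z i. z \<in> weighted_polydisc \<omega> R \<Longrightarrow> cmod (z $ i) = R ^ (\<omega> $ i) \<Longrightarrow>
      \<exists>j. 4 * b j \<le> cmod (mp_eval (F $ j) z - mp_eval (F $ j) z0)"
  shows "complex_box (poly_map F z0) b \<subseteq> poly_map F ` weighted_polydisc \<omega> R"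
proof -
  define \<eta> where "\<eta> = poly_map F z0"
  define \<Omega> where "\<Omega> = {z :: complex ^ 'n. \<forall>i. cmod (z $ i) < R ^ (\<omega> $ i)}"
  define W where "W = {w :: complex ^ 'n. \<forall>i. \<bar>Re (w $ i - \<eta> $ i)\<bar> < 2 * b i \<and> \<bar>Im (w $ i - \<eta> $ i)\<bar> < 2 * b i}"
  let ?K = "weighted_polydisc \<omega> R :: (complex ^ 'n) set" and ?W = "{w \<in> W. mp_eval D w \<noteq> 0}"
  have \<Omega>K: "\<Omega> \<subseteq> ?K"
    by (auto simp: \<Omega>_def weighted_polydisc_def polydisc_def less_imp_le)
  have "\<Omega> = (\<Inter>i. {z. cmod (z $ i) < R ^ (\<omega> $ i)})"
    by (auto simp: \<Omega>_def)
  then have "open \<Omega>"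
    by (auto intro!: open_INT open_Collect_less continuous_intros)
  have W: "W = (\<Inter>i. {w. \<bar>Re (w $ i - \<eta> $ i)\<bar> < 2 * b i} \<inter> {w. \<bar>Im (w $ i - \<eta> $ i)\<bar> < 2 * b i})"
    by (auto simp: W_def)
  have "open W" unfolding W
    by (intro open_INT ballI open_Int open_Collect_less continuous_intros finite)
  have "convex W"
  proof -
    have "convex {w :: complex ^ 'n. \<bar>Re (w $ i - \<eta> $ i)\<bar> < 2 * b i}"
      and "convex {w :: complex ^ 'n. \<bar>Im (w $ i - \<eta> $ i)\<bar> < 2 * b i}" for i
    proof -
      have lin: "linear (\<lambda>w :: complex ^ 'n. Re (w $ i))" "linear (\<lambda>w :: complex ^ 'n. Im (w $ i))"
        by (auto intro!: linearI)
      have "{w :: complex ^ 'n. \<bar>Re (w $ i - \<eta> $ i)\<bar> < 2 * b i} =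
        (\<lambda>w. Re (w $ i)) -` {Re (\<eta> $ i) - 2 * b i <..< Re (\<eta> $ i) + 2 * b i}"
        by auto
      then show "convex {w :: complex ^ 'n. \<bar>Re (w $ i - \<eta> $ i)\<bar> < 2 * b i}"
        using convex_linear_vimage[OF lin(1)] by simp
      have "{w :: complex ^ 'n. \<bar>Im (w $ i - \<eta> $ i)\<bar> < 2 * b i} =
        (\<lambda>w. Im (w $ i)) -` {Im (\<eta> $ i) - 2 * b i <..< Im (\<eta> $ i) + 2 * b i}"
        by auto
      then show "convex {w :: complex ^ 'n. \<bar>Im (w $ i - \<eta> $ i)\<bar> < 2 * b i}"
        using convex_linear_vimage[OF lin(2)] by simp
    qed
    then show ?thesis
      unfolding W by (intro convex_INT convex_Int)
  qed
  have inner: "poly_map F z \<notin> W" if z: "z \<in> ?K" "z \<notin> \<Omega>" for z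
  proof
    assume FW: "poly_map F z \<in> W"
    from z obtain i where "cmod (z $ i) = R ^ (\<omega> $ i)"
      by (auto simp: \<Omega>_def weighted_polydisc_def polydisc_def not_less intro: antisym)
    with z bd obtain j where j: "4 * b j \<le> cmod (mp_eval (F $ j) z - mp_eval (F $ j) z0)" by blast
    have "cmod (mp_eval (F $ j) z - mp_eval (F $ j) z0) \<le>
        \<bar>Re (mp_eval (F $ j) z - mp_eval (F $ j) z0)\<bar> + \<bar>Im (mp_eval (F $ j) z - mp_eval (F $ j) z0)\<bar>"
      by (rule cmod_le)
    moreover have "\<bar>Re (mp_eval (F $ j) z - mp_eval (F $ j) z0)\<bar> < 2 * b j"
      "\<bar>Im (mp_eval (F $ j) z - mp_eval (F $ j) z0)\<bar> < 2 * b j"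
      using FW unfolding W_def \<eta>_def by (auto dest!: spec[of _ j])
    ultimately show False using j by linarith
  qed
  have "compact ?K" unfolding weighted_polydisc_def by (rule compact_polydisc)
  then have closedK: "closed (poly_map F ` ?K)"
    by (intro compact_imp_closed compact_continuous_image continuous_on_poly_map[OF continuous_on_id])
  have "poly_map F ` \<Omega> \<inter> ?W = ?W \<inter> poly_map F ` ?K"
    using \<Omega>K inner by blast
  then have "closedin (top_of_set ?W) (poly_map F ` \<Omega> \<inter> ?W)"
    using closedin_closed_Int[OF closedK] by simp
  moreover have "\<eta> \<in> poly_map F ` \<Omega> \<inter> ?W"
    using z0 b by (auto simp: \<eta>_def \<Omega>_def W_def)
  then have "poly_map F ` \<Omega> \<inter> ?W \<noteq> {}" by blast
  moreover have "D \<noteq> 0" using z0(2) by auto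
  ultimately have "?W \<subseteq> poly_map F ` \<Omega>"
    using crit \<open>convex W\<close> \<open>open W\<close> \<open>open \<Omega>\<close>
    by (intro poly_map_image_clopen[of F D W \<Omega>]) blast+
  then have WK: "?W \<subseteq> poly_map F ` ?K" using \<Omega>K by blast
  \<comment> \<open>The missing points of W form an open set on which D vanishes.\<close>
  have "open (W - poly_map F ` ?K)" using \<open>open W\<close> closedK by (rule open_Diff)
  then have "W \<subseteq> poly_map F ` ?K"
    using mp_eval_open_eq_0[of "W - poly_map F ` ?K" D] \<open>D \<noteq> 0\<close> WK by blast
  moreover have "complex_box \<eta> b \<subseteq> W"
  proof
    fix w assume w: "w \<in> complex_box \<eta> b"
    have "\<bar>Re (w $ i - \<eta> $ i)\<bar> \<le> b i" "\<bar>Im (w $ i - \<eta> $ i)\<bar> \<le> b i" "b i < 2 * b i" for i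
      using w b[of i] unfolding complex_box_def by auto
    then show "w \<in> W"
      unfolding W_def by (blast intro: le_less_trans)
  qed
  ultimately show ?thesis by (simp add: \<eta>_def)
qed

text \<open>The weighted polydisc of radius R has volume of order R to the power 2 * (sum of the weights), and
  its image contains a box with volume of order R to the power 2 * (sum of the lam $ i). The squared
  Jacobian is at most of order R to the power 2 * wdeg J on it, so the volume inequality for large
  R compares the exponents.\<close>

lemma weighted_proper_wdeg_jacobian:
  fixes F :: "(complex, 'n::finite) mpoly ^ 'n"
  assumes crit: "\<And>z. mp_eval (det (mp_jacobian F)) z = 0 \<Longrightarrow> mp_eval D (poly_map F z) = 0"
    and J: "det (mp_jacobian F) \<noteq> 0"
    and \<omega>: "\<And>i. 0 < \<omega> $ i"
    and \<eta>: "mp_eval D \<eta> \<noteq> 0" "\<eta> \<in> range (poly_map F)"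
    and proper: "weighted_proper_at \<omega> lam F \<eta>"
  shows "ereal (\<Sum>i\<in>UNIV. of_rat (lam $ i) - real (\<omega> $ i)) \<le> wdeg \<omega> (det (mp_jacobian F))"
proof -
  let ?J = "det (mp_jacobian F)" and ?n = "CARD('n)"
  let ?l = "\<lambda>i. of_rat (lam $ i) :: real"
  obtain z0 where z0: "\<eta> = poly_map F z0" using \<eta>(2) by blast
  obtain c B where c: "0 < c" and "compact B" and
    lower: "\<And>z. z \<notin> B \<Longrightarrow> c \<le> (\<Sum>i\<in>UNIV. cmod (mp_eval (F $ i) z - \<eta> $ i) / wrho \<omega> z powr ?l i)"
    using proper unfolding weighted_proper_at_def by blast
  obtain M where M: "\<And>z. z \<in> B \<Longrightarrow> norm z \<le> M"
    using compact_imp_bounded[OF \<open>compact B\<close>] unfolding bounded_iff by blast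
  obtain C d where C: "0 \<le> C" "wdeg \<omega> ?J = ereal (real d)"
    "\<And>R z. 1 \<le> R \<Longrightarrow> z \<in> weighted_polydisc \<omega> R \<Longrightarrow> cmod (mp_eval ?J z) \<le> C * R ^ d"
    using mp_eval_weighted_bound[OF J, of \<omega>] by blast
  (* The box has half-widths \<epsilon> * R powr lam $ i, and then 4 * \<epsilon> summed over all i gives c. *)
  define \<epsilon> where "\<epsilon> = c / (4 * real ?n)"
  have \<epsilon>: "0 < \<epsilon>" using c by (simp add: \<epsilon>_def)
  define R1 where "R1 = 1 + \<bar>M\<bar> + norm z0"
  define s where "s = (\<Sum>i\<in>UNIV. ?l i - real (\<omega> $ i)) - real d"
  have growth: "\<epsilon> ^ ?n * R powr s \<le> C" if R: "R1 \<le> R" for R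
  proof -
    have R_1: "1 \<le> R" and RM: "M < R" and Rz: "norm z0 < R"
      using R norm_ge_zero[of z0] unfolding R1_def by linarith+
    have R_pow: "R \<le> R ^ (\<omega> $ i)" for i
      using power_increasing[of 1 "\<omega> $ i" R] \<omega>[of i] R_1 by simp
    define b where "b i = \<epsilon> * R powr ?l i" for i
    have b: "0 < b i" for i using \<epsilon> R_1 by (simp add: b_def)
    have cover: "complex_box \<eta> b \<subseteq> poly_map F ` weighted_polydisc \<omega> R"
      unfolding z0
    proof (rule weighted_proper_image_covers_box[OF crit \<omega> R_1 _ _ b])
      show "cmod (z0 $ i) < R ^ (\<omega> $ i)" for i
        using Finite_Cartesian_Product.norm_nth_le[of z0 i] R_pow[of i] Rz by linarith
      show "mp_eval D (poly_map F z0) \<noteq> 0" using \<eta>(1) z0 by simp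
      fix z i assume z: "z \<in> weighted_polydisc \<omega> R" "cmod (z $ i) = R ^ (\<omega> $ i)"
      have "wrho \<omega> z = R" by (rule wrho_boundary[OF \<omega> R_1 z])
      moreover have "z \<notin> B"
        using M[of z] Finite_Cartesian_Product.norm_nth_le[of z i] R_pow[of i] RM z(2) by linarith
      ultimately have le: "c \<le> (\<Sum>i\<in>UNIV. cmod (mp_eval (F $ i) z - \<eta> $ i) / R powr ?l i)"
        using lower[of z] by simp
      show "\<exists>j. 4 * b j \<le> cmod (mp_eval (F $ j) z - mp_eval (F $ j) z0)"
      proof (rule ccontr)
        assume "\<not> ?thesis"
        then have "cmod (mp_eval (F $ j) z - \<eta> $ j) / R powr ?l j < 4 * \<epsilon>" for j
          using R_1 by (simp add: not_le z0 b_def pos_divide_less_eq mult.assoc)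
        then have "(\<Sum>i\<in>UNIV. cmod (mp_eval (F $ i) z - \<eta> $ i) / R powr ?l i) < (\<Sum>i\<in>(UNIV :: 'n set). 4 * \<epsilon>)"
          by (intro sum_strict_mono) auto
        also have "\<dots> = c" by (simp add: \<epsilon>_def)
        finally show False using le by simp
      qed
    qed
    have "(\<Prod>i\<in>UNIV. b i) \<le> (C * R ^ d) * (\<Prod>i\<in>UNIV. R ^ (\<omega> $ i))"
    proof (rule poly_map_volume_bound[OF _ _ _ _ cover])
      show "compact (weighted_polydisc \<omega> R :: (complex ^ 'n) set)"
        unfolding weighted_polydisc_def by (rule compact_polydisc)
      show "weighted_polydisc \<omega> R \<subseteq> complex_box (0 :: complex ^ 'n) (\<lambda>i. R ^ (\<omega> $ i))"
        by (auto simp: weighted_polydisc_def polydisc_def complex_box_def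
            intro: order_trans[OF abs_Re_le_cmod] order_trans[OF abs_Im_le_cmod])
    qed (use C R_1 b in \<open>auto intro: less_imp_le\<close>)
    also have "(\<Prod>i\<in>UNIV. b i) = \<epsilon> ^ ?n * R powr (\<Sum>i\<in>UNIV. ?l i)"
      using R_1 by (simp add: b_def prod.distrib powr_sum)
    also have "(C * R ^ d) * (\<Prod>i\<in>UNIV. R ^ (\<omega> $ i)) = C * R powr (real d + (\<Sum>i\<in>UNIV. real (\<omega> $ i)))"
      using R_1 by (simp add: powr_add powr_sum powr_realpow)
    finally have "\<epsilon> ^ ?n * R powr (\<Sum>i\<in>UNIV. ?l i) / R powr (real d + (\<Sum>i\<in>UNIV. real (\<omega> $ i))) \<le> C"
      using R_1 by (simp add: pos_divide_le_eq)
    then show ?thesis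
      by (simp add: s_def powr_diff sum_subtractf powr_add mult.commute)
  qed
  have "s \<le> 0"
  proof (rule ccontr)
    assume "\<not> s \<le> 0"
    then have s: "0 < s" by simp
    define X where "X = C / \<epsilon> ^ ?n + 1"
    have X: "0 < X" using C(1) \<epsilon> by (simp add: X_def add_nonneg_pos)
    define R where "R = max R1 (X powr (1 / s))"
    have "X = (X powr (1 / s)) powr s" using s X by (simp add: powr_powr)
    also have "\<dots> \<le> R powr s" using s by (intro powr_mono2) (auto simp: R_def)
    also have "\<dots> \<le> C / \<epsilon> ^ ?n"
      using growth[of R] \<epsilon> by (simp add: R_def pos_le_divide_eq mult.commute)
    finally show False by (simp add: X_def)
  qed
  then show ?thesis by (simp add: C(2) s_def)
qed

text \<open>The open set consists of attained regular values of F. It is chosen before \<omega> and lam, and serves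
  all of them.\<close>

lemma jacobian_zero_of_weighted_proper:
  fixes F :: "(complex, 'n::finite) mpoly ^ 'n"
  obtains U where "zariski_open U" "U \<noteq> {}"
    "\<And>\<eta> \<omega> lam. \<eta> \<in> U \<Longrightarrow> (\<And>i. 0 < \<omega> $ i) \<Longrightarrow> weighted_proper_at \<omega> lam F \<eta> \<Longrightarrow>
       wdeg \<omega> (det (mp_jacobian F)) < ereal (\<Sum>i\<in>UNIV. of_rat (lam $ i) - real (\<omega> $ i)) \<Longrightarrow>
       det (mp_jacobian F) = 0"
proof (cases "det (mp_jacobian F) = 0")
  case True
  have "zariski_open (UNIV :: (complex ^ 'n) set)"
    unfolding zariski_open_def by (intro exI[of _ "{1}"]) auto
  with True show thesis by (intro that[of UNIV]) auto
next
  case False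
  obtain D where D: "D \<noteq> 0"
    "\<And>z. mp_eval (det (mp_jacobian F)) z = 0 \<Longrightarrow> mp_eval D (poly_map F z) = 0"
    "\<And>w. mp_eval D w \<noteq> 0 \<Longrightarrow> w \<in> range (poly_map F)"
    using poly_map_generic_values[OF False] by blast
  show thesis
  proof (rule that[of "{w. mp_eval D w \<noteq> 0}"])
    show "zariski_open {w. mp_eval D w \<noteq> 0}"
      unfolding zariski_open_def by (intro exI[of _ "{D}"]) auto
    show "{w. mp_eval D w \<noteq> 0} \<noteq> {}"
      using mp_eqI[of D 0] D(1) by auto
    fix \<eta> \<omega> lam
    assume "\<eta> \<in> {w. mp_eval D w \<noteq> 0}" "\<And>i. 0 < \<omega> $ i" "weighted_proper_at \<omega> lam F \<eta>"
      and lt: "wdeg \<omega> (det (mp_jacobian F)) < ereal (\<Sum>i\<in>UNIV. of_rat (lam $ i) - real (\<omega> $ i))"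
    then have "ereal (\<Sum>i\<in>UNIV. of_rat (lam $ i) - real (\<omega> $ i)) \<le> wdeg \<omega> (det (mp_jacobian F))"
      using weighted_proper_wdeg_jacobian[OF D(2) False] D(3) by blast
    with lt show "det (mp_jacobian F) = 0" by simp
  qed
qed

section \<open>The characteristic expansion of the Hessian determinant\<close>

text \<open>Expanding the product over the rows chooses the set S of rows taken from A; the rows
  of the identity matrix outside S force the permutation to fix the complement of S.\<close>

lemma det_one_plus:
  fixes A :: "'a::comm_ring_1 ^ 'n::finite ^ 'n"
  shows "det (mat 1 + A) = (\<Sum>S\<in>UNIV. principal_minor A S)"
proof -
  have "det (mat 1 + A) = (\<Sum>\<pi> | \<pi> permutes UNIV. of_int (sign \<pi>) *
      (\<Sum>S\<in>UNIV. (\<Prod>i\<in>S. A $ i $ \<pi> i) * (\<Prod>i\<in>-S. mat 1 $ i $ \<pi> i)))"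
    unfolding det_def
    by (rule sum.cong) (simp_all add: add.commute[of "mat 1 $ _ $ _"] prod_add Compl_eq_Diff_UNIV)
  also have "\<dots> = (\<Sum>S\<in>UNIV. \<Sum>\<pi> | \<pi> permutes UNIV. of_int (sign \<pi>) *
      ((\<Prod>i\<in>S. A $ i $ \<pi> i) * (\<Prod>i\<in>-S. mat 1 $ i $ \<pi> i)))"
    unfolding sum_distrib_left by (rule sum.swap)
  also have "\<dots> = (\<Sum>S\<in>UNIV. principal_minor A S)"
  proof (rule sum.cong[OF refl])
    fix S :: "'n set"
    have "(\<Sum>\<pi> | \<pi> permutes UNIV. of_int (sign \<pi>) *
          ((\<Prod>i\<in>S. A $ i $ \<pi> i) * (\<Prod>i\<in>-S. mat 1 $ i $ \<pi> i))) =
        (\<Sum>\<pi> | \<pi> permutes S. of_int (sign \<pi>) *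
          ((\<Prod>i\<in>S. A $ i $ \<pi> i) * (\<Prod>i\<in>-S. mat 1 $ i $ \<pi> i)))"
    proof (rule sum.mono_neutral_right)
      show "\<forall>\<pi>\<in>{\<pi>. \<pi> permutes UNIV} - {\<pi>. \<pi> permutes S}.
          of_int (sign \<pi>) * ((\<Prod>i\<in>S. A $ i $ \<pi> i) * (\<Prod>i\<in>-S. mat 1 $ i $ \<pi> i)) = 0"
      proof
        fix \<pi> :: "'n \<Rightarrow> 'n" assume "\<pi> \<in> {\<pi>. \<pi> permutes UNIV} - {\<pi>. \<pi> permutes S}"
        then obtain i where "i \<in> -S" "\<pi> i \<noteq> i" unfolding permutes_def by auto
        then have "(\<Prod>i\<in>-S. mat 1 $ i $ \<pi> i) = (0 :: 'a)"
          by (intro prod_zero) (auto simp: mat_def intro!: bexI[of _ i])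
        then show "of_int (sign \<pi>) * ((\<Prod>i\<in>S. A $ i $ \<pi> i) * (\<Prod>i\<in>-S. mat 1 $ i $ \<pi> i)) = 0"
          by simp
      qed
    qed (auto intro: permutes_subset finite_permutations)
    also have "\<dots> = principal_minor A S"
      unfolding principal_minor_def
    proof (rule sum.cong[OF refl])
      fix \<pi> assume "\<pi> \<in> {\<pi>. \<pi> permutes S}"
      then have "\<pi> i = i" if "i \<in> -S" for i using that by (auto simp: permutes_not_in)
      then have "(\<Prod>i\<in>-S. mat 1 $ i $ \<pi> i) = (1 :: 'a)"
        by (intro prod.neutral) (simp add: mat_def)
      then show "of_int (sign \<pi>) * ((\<Prod>i\<in>S. A $ i $ \<pi> i) * (\<Prod>i\<in>-S. mat 1 $ i $ \<pi> i)) =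
          of_int (sign \<pi>) * (\<Prod>i\<in>S. A $ i $ \<pi> i)"
        by simp
    qed
    finally show "(\<Sum>\<pi> | \<pi> permutes UNIV. of_int (sign \<pi>) *
          ((\<Prod>i\<in>S. A $ i $ \<pi> i) * (\<Prod>i\<in>-S. mat 1 $ i $ \<pi> i))) = principal_minor A S" .
  qed
  finally show ?thesis .
qed

lemma det_one_plus_minor_sums:
  fixes A :: "'a::comm_ring_1 ^ 'n::finite ^ 'n"
  shows "det (mat 1 + A) = (\<Sum>k\<le>CARD('n). minor_sum k A)"
proof -
  have "(\<Sum>k\<le>CARD('n). \<Sum>S | S \<in> UNIV \<and> card S = k. principal_minor A S) = (\<Sum>S\<in>UNIV. principal_minor A S)"
    by (rule sum.group) (auto simp: card_mono)
  then show ?thesis by (simp add: det_one_plus minor_sum_def)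
qed

lemma minor_sum_0: "minor_sum 0 (A :: 'a::comm_ring_1 ^ 'n::finite ^ 'n) = 1"
proof -
  have "{S :: 'n set. card S = 0} = {{}}" by auto
  then show ?thesis by (simp add: minor_sum_def principal_minor_def)
qed

lemma minor_sum_CARD: "minor_sum CARD('n) (A :: 'a::comm_ring_1 ^ 'n::finite ^ 'n) = det A"
proof -
  have "{S :: 'n set. card S = CARD('n)} = {UNIV}" 
    using card_subset_eq[of "UNIV :: 'n set"] by auto
  then show ?thesis by (simp add: minor_sum_def principal_minor_def det_def)
qed

lemma lookup_const_mult:
  "Poly_Mapping.lookup (mp_const c * p) m = c * Poly_Mapping.lookup (p :: ('a::comm_semiring_1, 'n) mpoly) m"
  unfolding mp_const_def mult_map_scale_conv_mult[symmetric] by (simp add: map.rep_eq when_def)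

lemma mp_const_mult: "mp_const c * mp_const d = (mp_const (c * d) :: ('a::comm_semiring_1, 'n) mpoly)"
  by (simp add: mp_const_def mult_single)

lemma mp_const_0 [simp]: "mp_const 0 = 0"
  by (simp add: mp_const_def)

lemma mp_const_1 [simp]: "mp_const 1 = 1"
  by (simp add: mp_const_def)

lemma mp_partial_const_mult: "mp_partial i (mp_const c * p) = mp_const c * mp_partial i p"
  by (intro poly_mapping_eqI) (simp add: lookup_mp_partial lookup_const_mult mult.left_commute)

lemma lookup_hom_part:
  "Poly_Mapping.lookup (hom_part j p) m = (Poly_Mapping.lookup p m when mon_degree m = j)"
  by (auto simp: hom_part_def lookup_sum lookup_single when_def in_keys_iff)

lemma lookup_hom_part_ge:
  "Poly_Mapping.lookup (hom_part_ge d p) m = (Poly_Mapping.lookup p m when d \<le> mon_degree m)"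
proof -
  have "Poly_Mapping.lookup (hom_part_ge d p) m =
      (\<Sum>j | j \<in> mon_degree ` Poly_Mapping.keys p \<and> d \<le> j. if j = mon_degree m then Poly_Mapping.lookup p m else 0)"
    unfolding hom_part_ge_def lookup_sum lookup_hom_part by (intro sum.cong) (auto simp: when_def)
  then show ?thesis by (auto simp: when_def in_keys_iff)
qed

lemma mp_eval_at_0:
  fixes p :: "('a::comm_semiring_1, 'n::finite) mpoly"
  shows "mp_eval p 0 = Poly_Mapping.lookup p 0"
proof -
  have "mon_eval m 0 = (if m = 0 then 1 else 0 :: 'a)" for m :: "'n \<Rightarrow>\<^sub>0 nat"
  proof (cases "m = 0")
    case False
    then obtain i where "Poly_Mapping.lookup m i \<noteq> 0"
      by (metis poly_mapping_eqI lookup_zero)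
    then show ?thesis
      using False by (auto simp: mon_eval_def power_0_left intro!: prod_zero)
  qed simp
  then show ?thesis
    by (simp add: mp_eval_superset[OF finite_keys order_refl] in_keys_iff
          if_distrib[of "\<lambda>x. _ * x"] cong: if_cong)
qed

definition lorentz_sign :: "4 \<Rightarrow> real" where
  "lorentz_sign i = (if i = 1 then -1 else 1)"

lemma Gmat_nth: "Gmat $ i $ j = (if i = j then lorentz_sign i else 0)"
  by (simp add: Gmat_def lorentz_sign_def)

lemma lorentz_sign_square [simp]: "lorentz_sign i * lorentz_sign i = 1"
  by (simp add: lorentz_sign_def)

lemma sum_diag_mult:
  fixes f g :: "'n::finite \<Rightarrow> 'a::comm_ring_1"
  shows "(\<Sum>k\<in>UNIV. (if i = k then f k else 0) * g k) = f i * g i"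
  by (simp add: if_distrib[of "\<lambda>x. x * _"] cong: if_cong)

lemma matrix_inv_Gmat: "matrix_inv Gmat = Gmat"
proof -
  have GG: "Gmat ** Gmat = mat 1"
    by (simp add: vec_eq_iff matrix_matrix_mult_def Gmat_nth mat_def sum_diag_mult)
  show ?thesis
    unfolding matrix_inv_def
  proof (rule some_equality)
    fix B assume "Gmat ** B = mat 1 \<and> B ** Gmat = mat 1"
    then show "B = Gmat"
      by (metis GG matrix_mul_assoc matrix_mul_lid matrix_mul_rid)
  qed (simp add: GG)
qed

lemma mp_const_Gmat: "mp_const (Gmat $ i $ j) = (if i = j then mp_const (lorentz_sign i) else 0)"
  by (simp add: Gmat_nth)

lemma L_mat_nth:
  "L_mat \<phi> $ i $ k = mp_const (lorentz_sign i) * mp_partial i (mp_partial k (hom_part_ge 3 \<phi>))"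
  by (simp add: L_mat_def matrix_inv_Gmat matrix_matrix_mult_def mp_const_Gmat
        sum_diag_mult mp_hess_def)

lemma gradient_map_nth:
  "gradient_map \<phi> $ i = mp_complex (mp_const (lorentz_sign i) * mp_partial i (hom_part_ge 3 \<phi>))"
  by (simp add: gradient_map_def matrix_inv_Gmat matrix_vector_mult_def mp_const_Gmat
        sum_diag_mult mp_grad_def del: mp_complex_sum mp_complex_mult)

lemma jacobian_gradient_map: "mp_jacobian (gradient_map \<phi>) = map_matrix mp_complex (L_mat \<phi>)"
  by (simp add: vec_eq_iff mp_jacobian_def map_matrix_def gradient_map_nth L_mat_nth
        mp_partial_mp_complex mp_partial_const_mult mp_partial_commute del: mp_complex_mult)

text \<open>The hypothesis fixes p as a function, so the formal partial derivatives are obtained by comparing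
  with the derivatives of that function.\<close>

lemma quadratic_part_partials:
  assumes "\<forall>x. 2 * mp_eval p x = (Gmat *v x) \<bullet> x"
  shows "mp_partial i (mp_partial k p) = mp_const (Gmat $ i $ k)"
proof -
  have p: "mp_eval p = (\<lambda>x. \<Sum>i\<in>UNIV. lorentz_sign i / 2 * (x $ i)\<^sup>2)"
  proof
    fix x
    have "2 * mp_eval p x = (\<Sum>i\<in>UNIV. lorentz_sign i * (x $ i)\<^sup>2)"
      using assms by (simp add: inner_vec_def matrix_vector_mult_def Gmat_nth sum_diag_mult
          power2_eq_square mult.assoc)
    moreover have "(\<Sum>i\<in>UNIV. lorentz_sign i / 2 * (x $ i)\<^sup>2) = (\<Sum>i\<in>UNIV. lorentz_sign i * (x $ i)\<^sup>2) / 2"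
      by (simp add: sum_divide_distrib)
    ultimately show "mp_eval p x = (\<Sum>i\<in>UNIV. lorentz_sign i / 2 * (x $ i)\<^sup>2)" by simp
  qed
  have 1: "mp_eval (mp_partial k p) x = lorentz_sign k * x $ k" for x
  proof -
    have "(mp_eval p has_derivative (\<lambda>v. \<Sum>i\<in>UNIV. lorentz_sign i / 2 * (of_nat 2 * v $ i * x $ i ^ (2 - 1)))) (at x)"
      unfolding p
      by (intro has_derivative_sum has_derivative_mult_right has_derivative_power
            bounded_linear_imp_has_derivative bounded_linear_vec_nth)
    also have "(\<lambda>v. \<Sum>i\<in>UNIV. lorentz_sign i / 2 * (of_nat 2 * v $ i * x $ i ^ (2 - 1))) =
        (\<lambda>v. \<Sum>i\<in>UNIV. lorentz_sign i * x $ i * v $ i)"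
      by (simp add: mult_ac)
    finally show ?thesis
      using mp_eval_partial_eqI[of p _ x k]
      by (simp add: axis_def if_distrib[of "\<lambda>x. _ * x"] cong: if_cong)
  qed
  show ?thesis
  proof (rule mp_eqI)
    fix x
    have "mp_eval (mp_partial k p) = (\<lambda>x. lorentz_sign k * x $ k)" using 1 by (simp add: fun_eq_iff)
    moreover have "((\<lambda>x. lorentz_sign k * x $ k) has_derivative (\<lambda>v. lorentz_sign k * v $ k)) (at x)"
      by (intro has_derivative_mult_right bounded_linear_imp_has_derivative bounded_linear_vec_nth)
    ultimately have "(mp_eval (mp_partial k p) has_derivative (\<lambda>v. lorentz_sign k * v $ k)) (at x)"
      by simp
    from mp_eval_partial_eqI[OF this, of i]
    show "mp_eval (mp_partial i (mp_partial k p)) x = mp_eval (mp_const (Gmat $ i $ k)) x"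
      by (simp add: axis_def Gmat_nth)
  qed
qed

text \<open>Factoring out the Gram matrix of the quadratic part gives det (Hess \<phi>) = - det (1 + L), where L
  vanishes at the origin. Hence the constant is -1 and det (1 + L) = 1; expanding the latter in
  principal minors gives the claim.\<close>

lemma sigma_le3_eq_minus_det:
  fixes \<phi> :: "(real, 4) mpoly"
  assumes det: "det (mp_hess \<phi>) = 1 \<or> det (mp_hess \<phi>) = -1"
    and 0: "hom_part 0 \<phi> = 0" and 1: "hom_part 1 \<phi> = 0"
    and 2: "\<forall>x. 2 * mp_eval (hom_part 2 \<phi>) x = (Gmat *v x) \<bullet> x"
  shows "sigma_le3 \<phi> = - det (L_mat \<phi>)"
proof -
  let ?\<psi> = "hom_part_ge 3 \<phi>"
  have \<phi>: "\<phi> = hom_part 2 \<phi> + ?\<psi>"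
  proof (rule poly_mapping_eqI)
    fix m
    have "Poly_Mapping.lookup (hom_part 0 \<phi>) m = 0" "Poly_Mapping.lookup (hom_part 1 \<phi>) m = 0"
      by (simp_all only: 0 1 lookup_zero)
    then have "mon_degree m < 2 \<Longrightarrow> Poly_Mapping.lookup \<phi> m = 0"
      unfolding lookup_hom_part by (cases "mon_degree m = 0") (auto simp: when_def less_2_cases_iff)
    then show "Poly_Mapping.lookup \<phi> m = Poly_Mapping.lookup (hom_part 2 \<phi> + ?\<psi>) m"
      by (cases "mon_degree m < 2"; cases "mon_degree m = 2")
         (auto simp: lookup_add lookup_hom_part lookup_hom_part_ge)
  qed
  have "mp_hess \<phi> = map_matrix mp_const Gmat ** (mat 1 + L_mat \<phi>)"
  proof -
    have part: "mp_partial i (mp_partial k \<phi>) = mp_const (Gmat $ i $ k) + mp_partial i (mp_partial k ?\<psi>)" for i k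
      by (subst \<phi>) (simp add: quadratic_part_partials[OF 2])
    have sq: "mp_const (lorentz_sign i) * (mp_const (lorentz_sign i) * q) = q" for i and q :: "(real, 4) mpoly"
      by (simp add: mp_const_mult flip: mult.assoc)
    show ?thesis
      by (simp add: vec_eq_iff mp_hess_def matrix_matrix_mult_def mp_const_Gmat part sq
            sum_diag_mult mat_def L_mat_nth distrib_left sum.distrib)
  qed
  moreover have "det (map_matrix mp_const Gmat) = (-1 :: (real, 4) mpoly)"
  proof -
    have "det (map_matrix mp_const Gmat) = (\<Prod>i\<in>UNIV. mp_const (lorentz_sign i) :: (real, 4) mpoly)"
      by (subst det_diagonal) (auto simp: mp_const_Gmat)
    also have "\<dots> = (\<Prod>i\<in>UNIV. if i = (1 :: 4) then mp_const (-1) else 1)"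
      by (intro prod.cong) (auto simp: lorentz_sign_def)
    also have "\<dots> = mp_const (-1)" by simp
    also have "\<dots> = -1" by (simp add: mp_const_def single_uminus)
    finally show ?thesis .
  qed
  ultimately have hess: "det (mp_hess \<phi>) = - det (mat 1 + L_mat \<phi>)"
    by (simp add: det_mul)
  have "mp_eval (L_mat \<phi> $ i $ k) 0 = 0" for i k
    by (simp add: L_mat_nth mp_eval_at_0 lookup_const_mult lookup_mp_partial lookup_hom_part_ge mon_degree_def
          lookup_add lookup_single sum.distrib when_def)
  then have "map_matrix (\<lambda>p. mp_eval p 0) (mat 1 + L_mat \<phi>) = mat 1"
    by (simp add: vec_eq_iff map_matrix_def mat_def)
  then have "mp_eval (det (mp_hess \<phi>)) 0 = -1"
    by (simp add: hess mp_eval_det)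
  with det have "det (mp_hess \<phi>) = -1" by auto
  then have "det (mat 1 + L_mat \<phi>) = 1" using hess by simp
  moreover have "det (mat 1 + L_mat \<phi>) = 1 + sigma_le3 \<phi> + det (L_mat \<phi>)"
  proof -
    have 4: "CARD(4) = 4" by simp
    have "{..4} = {0, 1, 2, 3, 4 :: nat}" by auto
    then have "(\<Sum>k\<le>4. minor_sum k (L_mat \<phi>)) = 1 + sigma_le3 \<phi> + minor_sum 4 (L_mat \<phi>)"
      by (simp add: minor_sum_0 sigma_le3_def add_ac)
    then show ?thesis
      using det_one_plus_minor_sums[of "L_mat \<phi>"] minor_sum_CARD[of "L_mat \<phi>"]
      by (simp only: 4)
  qed
  ultimately show ?thesis by (simp add: add_eq_0_iff2 add.assoc)
qed

lemma wdeg_uminus: "wdeg \<omega> (- p) = wdeg \<omega> (p :: ('a::ab_group_add, 'n::finite) mpoly)"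
  
proof -
  have "Poly_Mapping.keys (- p) = Poly_Mapping.keys p" by (auto simp: in_keys_iff)
  then show ?thesis by (simp add: wdeg_def)
qed

lemma wdeg_mp_complex: "wdeg \<omega> (mp_complex p) = wdeg \<omega> p"
  by (simp add: wdeg_def)

theorem corollary7p3:
  fixes \<phi> :: "(real, 4) mpoly"
  assumes "unimodular_hessian_potential 1 \<phi>"
    and "hom_part 0 \<phi> = 0"
    and "hom_part 1 \<phi> = 0"
    and "\<forall>x. 2 * mp_eval (hom_part 2 \<phi>) x = (Gmat *v x) \<bullet> x"
  shows "\<exists>U :: (complex^4) set. zariski_open U \<and> U \<noteq> {} \<and>
    (\<forall>\<eta>\<in>U. \<forall>(\<omega> :: nat^4) (lam :: rat^4).
       (\<forall>i. 0 < \<omega> $ i) \<longrightarrow>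
       weighted_proper_at \<omega> lam (gradient_map \<phi>) \<eta> \<longrightarrow>
       wdeg \<omega> (sigma_le3 \<phi>) < ereal (\<Sum>i\<in>UNIV. of_rat (lam $ i) - real (\<omega> $ i)) \<longrightarrow>
       det (L_mat \<phi>) = 0)"
proof -
  have jac: "det (mp_jacobian (gradient_map \<phi>)) = mp_complex (det (L_mat \<phi>))"
    by (simp add: jacobian_gradient_map mp_complex_det)
  have "wdeg \<omega> (sigma_le3 \<phi>) = wdeg \<omega> (det (mp_jacobian (gradient_map \<phi>)))" for \<omega>
    using assms sigma_le3_eq_minus_det[of \<phi>]
    by (simp add: unimodular_hessian_potential_def jac wdeg_uminus wdeg_mp_complex)
  moreover obtain U where "zariski_open U" "U \<noteq> {}"
    "\<And>\<eta> \<omega> lam. \<eta> \<in> U \<Longrightarrow> (\<And>i. 0 < \<omega> $ i) \<Longrightarrow> weighted_proper_at \<omega> lam (gradient_map \<phi>) \<eta> \<Longrightarrow>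
       wdeg \<omega> (det (mp_jacobian (gradient_map \<phi>))) < ereal (\<Sum>i\<in>UNIV. of_rat (lam $ i) - real (\<omega> $ i)) \<Longrightarrow>
       det (mp_jacobian (gradient_map \<phi>)) = 0"
    using jacobian_zero_of_weighted_proper[of "gradient_map \<phi>"] by blast
  ultimately show ?thesis
    using mp_complex_eq_0_iff[of "det (L_mat \<phi>)"] unfolding jac by (intro exI[of _ U]) auto
qed

end
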